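(* In $\mathsf{RCA}_0^\omega+\mathsf{QF\text{-}AC}^{2,1}$ one can prove $\mathsf{FAN}\to(\exists h)\mathsf{FAN}_{\mathsf{ef}}(h)$, where $\mathsf{FAN}$: for every binary tree $T$, if $(\forall\alpha^1\le_11)(\exists n^0)(\overline{\alpha}n\notin T)$ then $(\exists k^0)(\forall\beta^1\le_11)(\overline{\beta}k\notin T)$; $\mathsf{FAN}_{\mathsf{ef}}(h)$: for every binary tree $T$ and every $g^2$, if $(\forall\alpha\le_11)(\overline{\alpha}g(\alpha)\notin T)$ then $(\forall\beta\le_11)(\overline{\beta}h(g,T)\notin T)$.
   Context: $\mathsf{RCA}_0^\omega:=\mathsf{E\text{-}PRA}^{\omega*}+\mathsf{QF\text{-}AC}^{1,0}$, where $\mathsf{E\text{-}PRA}^{\omega*}$ is Kohlenbach's extensional primitive recursive arithmetic in all finite types with finite sequence types, and $\mathsf{QF\text{-}AC}^{\rho,\tau}$ is the schema $(\forall x^\rho)(\exists y^\tau)\varphi(x,y)\to(\exists F^{\rho\to\tau})(\forall x^\rho)\varphi(x,F(x))$ for quantifier-free $\varphi$ (with $\mathsf{QF\text{-}AC}^{2,1}$ allowing $x$ to be a tuple of objects of type at most 2 and $y$ a tuple of objects of type at most 1). A binary tree $T$ is a type-1 object coding a set of finite 0–1 sequences closed under initial segments; $\alpha^1\le_11$ means $(\forall n)\alpha(n)\le1$; $\overline{\alpha}n$ is the finite sequence $\langle\alpha(0),\dots,\alpha(n-1)\rangle$ of the first values of $\alpha$. *)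

theory Defs
  imports Main
begin

text \<open>
  A deep embedding of the many-sorted theory RCA_0^omega + QF-AC^{2,1}: finite types over the
  type 0 of natural numbers, closed under finite sequence types; combinator terms; formulas whose
  only atoms are equations of type 0; classical natural deduction.
\<close>

section \<open>Types and terms\<close>

datatype ty = N | Fun ty ty (infixr "\<rightarrow>" 70) | Seq ty

fun pure_ty :: "nat \<Rightarrow> ty" where
  "pure_ty 0 = N"
| "pure_ty (Suc n) = pure_ty n \<rightarrow> N"

text \<open>
  \<open>Rec\<close> is the recursor of type 0 only (no recursion of higher type).

  The types \<open>Seq \<sigma>\<close> are governed by length, entry and formation
  (\<open>Tab \<sigma> f n\<close> is the sequence \<open>f 0, \<dots>, f (n - 1)\<close>), so that an object of
  type \<open>Seq \<sigma>\<close> amounts to a number \<open>n\<close> together with the first \<open>n\<close> values of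
  a function from 0 to \<open>\<sigma>\<close>.  The empty sequence, concatenation and list recursion with values
  of type 0 are explicitly definable.  A list recursor with values of arbitrary type is not
  included, since it would yield the higher-type recursors.
\<close>

datatype con =
    Zero
  | Succ
  | K ty ty
  | S ty ty ty
  | Rec
  | Len ty
  | Ent ty
  | Tab ty

fun con_ty :: "con \<Rightarrow> ty" where
  "con_ty Zero = N"
| "con_ty Succ = N \<rightarrow> N"
| "con_ty (K \<sigma> \<tau>) = \<sigma> \<rightarrow> \<tau> \<rightarrow> \<sigma>"
| "con_ty (S \<rho> \<sigma> \<tau>) = (\<rho> \<rightarrow> \<sigma> \<rightarrow> \<tau>) \<rightarrow> (\<rho> \<rightarrow> \<sigma>) \<rightarrow> \<rho> \<rightarrow> \<tau>"
| "con_ty Rec = N \<rightarrow> N \<rightarrow> (N \<rightarrow> N \<rightarrow> N) \<rightarrow> N"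
| "con_ty (Len \<sigma>) = Seq \<sigma> \<rightarrow> N"
| "con_ty (Ent \<sigma>) = Seq \<sigma> \<rightarrow> N \<rightarrow> \<sigma>"
| "con_ty (Tab \<sigma>) = (N \<rightarrow> \<sigma>) \<rightarrow> N \<rightarrow> Seq \<sigma>"

text \<open>A variable carries its type: \<open>(0, N)\<close> and \<open>(0, N \<rightarrow> N)\<close> are different variables.\<close>

type_synonym var = "nat \<times> ty"

datatype tm = V var | C con | App tm tm (infixl "\<cdot>" 85)

fun res_ty :: "ty \<Rightarrow> ty" where
  "res_ty (\<sigma> \<rightarrow> \<tau>) = \<tau>"
| "res_ty \<sigma> = N"

text \<open>\<open>ty_of\<close> is meaningful on well-typed terms only.\<close>

fun ty_of :: "tm \<Rightarrow> ty" where
  "ty_of (V x) = snd x"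
| "ty_of (C c) = con_ty c"
| "ty_of (s \<cdot> t) = res_ty (ty_of s)"

fun wt :: "tm \<Rightarrow> bool" where
  "wt (V x) = True"
| "wt (C c) = True"
| "wt (s \<cdot> t) = (wt s \<and> wt t \<and> ty_of s = ty_of t \<rightarrow> ty_of (s \<cdot> t))"

fun fv_tm :: "tm \<Rightarrow> var set" where
  "fv_tm (V x) = {x}"
| "fv_tm (C c) = {}"
| "fv_tm (s \<cdot> t) = fv_tm s \<union> fv_tm t"

fun subst_tm :: "(var \<Rightarrow> tm) \<Rightarrow> tm \<Rightarrow> tm" where
  "subst_tm \<theta> (V x) = \<theta> x"
| "subst_tm \<theta> (C c) = C c"
| "subst_tm \<theta> (s \<cdot> t) = subst_tm \<theta> s \<cdot> subst_tm \<theta> t"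

text \<open>Lambda abstraction, defined from the combinators as usual.\<close>

fun lam :: "var \<Rightarrow> tm \<Rightarrow> tm" where
  "lam x (V y) =
     (if y = x
      then C (S (snd x) (snd x \<rightarrow> snd x) (snd x)) \<cdot> C (K (snd x) (snd x \<rightarrow> snd x))
             \<cdot> C (K (snd x) (snd x))
      else C (K (snd y) (snd x)) \<cdot> V y)"
| "lam x (C c) = C (K (con_ty c) (snd x)) \<cdot> C c"
| "lam x (s \<cdot> t) =
     (if x \<in> fv_tm (s \<cdot> t)
      then C (S (snd x) (ty_of t) (ty_of (s \<cdot> t))) \<cdot> lam x s \<cdot> lam x t
      else C (K (ty_of (s \<cdot> t)) (snd x)) \<cdot> (s \<cdot> t))"

abbreviation zero :: tm where "zero \<equiv> C Zero"
abbreviation suc :: "tm \<Rightarrow> tm" where "suc t \<equiv> C Succ \<cdot> t"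
abbreviation len :: "ty \<Rightarrow> tm \<Rightarrow> tm" where "len \<sigma> s \<equiv> C (Len \<sigma>) \<cdot> s"
abbreviation ent :: "ty \<Rightarrow> tm \<Rightarrow> tm \<Rightarrow> tm" where "ent \<sigma> s i \<equiv> C (Ent \<sigma>) \<cdot> s \<cdot> i"
abbreviation tab :: "ty \<Rightarrow> tm \<Rightarrow> tm \<Rightarrow> tm" where "tab \<sigma> f n \<equiv> C (Tab \<sigma>) \<cdot> f \<cdot> n"

fun zero_at :: "ty \<Rightarrow> tm" where
  "zero_at N = zero"
| "zero_at (\<sigma> \<rightarrow> \<tau>) = C (K \<tau> \<sigma>) \<cdot> zero_at \<tau>"
| "zero_at (Seq \<sigma>) = tab \<sigma> (C (K \<sigma> N) \<cdot> zero_at \<sigma>) zero"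

text \<open>Closed terms for predecessor, truncated subtraction and addition.\<close>

definition pred_tm :: tm where
  "pred_tm = lam (0, N) (C Rec \<cdot> V (0, N) \<cdot> zero \<cdot> lam (1, N) (lam (2, N) (V (2, N))))"

definition sub_tm :: tm where
  "sub_tm = lam (0, N) (lam (1, N)
     (C Rec \<cdot> V (1, N) \<cdot> V (0, N) \<cdot> lam (2, N) (lam (3, N) (pred_tm \<cdot> V (2, N)))))"

definition add_tm :: tm where
  "add_tm = lam (0, N) (lam (1, N)
     (C Rec \<cdot> V (1, N) \<cdot> V (0, N) \<cdot> lam (2, N) (lam (3, N) (suc (V (2, N))))))"

text \<open>Cantor pairing: \<open>pair m n = (0 + 1 + \<dots> + (m + n)) + m\<close>.\<close>

definition tri_tm :: tm where
  "tri_tm = lam (0, N)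
     (C Rec \<cdot> V (0, N) \<cdot> zero \<cdot> lam (1, N) (lam (2, N) (add_tm \<cdot> V (1, N) \<cdot> suc (V (2, N)))))"

definition pair_tm :: tm where
  "pair_tm = lam (0, N) (lam (1, N)
     (add_tm \<cdot> (tri_tm \<cdot> (add_tm \<cdot> V (0, N) \<cdot> V (1, N))) \<cdot> V (0, N)))"

text \<open>
  The (bijective) coding of finite sequences of numbers by numbers, a term of type
  \<open>Seq N \<rightarrow> N\<close>: the empty sequence has code 0, and the sequence \<open>s\<close> followed by
  the entry \<open>x\<close> has code \<open>pair (code s) x + 1\<close>.
\<close>

definition code_tm :: tm where
  "code_tm = lam (0, Seq N)
     (C Rec \<cdot> len N (V (0, Seq N)) \<cdot> zero
        \<cdot> lam (1, N) (lam (2, N) (suc (pair_tm \<cdot> V (1, N) \<cdot> ent N (V (0, Seq N)) (V (2, N))))))"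


section \<open>Formulas\<close>

datatype fm = Bot | Eq tm tm | Imp fm fm (infixr "\<^bold>\<longrightarrow>" 55) | Forall var fm

abbreviation Neg :: "fm \<Rightarrow> fm" where "Neg p \<equiv> p \<^bold>\<longrightarrow> Bot"
abbreviation Conj :: "fm \<Rightarrow> fm \<Rightarrow> fm" (infixr "\<^bold>\<and>" 60)
  where "p \<^bold>\<and> q \<equiv> Neg (p \<^bold>\<longrightarrow> Neg q)"
abbreviation Exists :: "var \<Rightarrow> fm \<Rightarrow> fm" where "Exists x p \<equiv> Neg (Forall x (Neg p))"

abbreviation Le :: "tm \<Rightarrow> tm \<Rightarrow> fm" where "Le s t \<equiv> Eq (sub_tm \<cdot> s \<cdot> t) zero"
abbreviation Less :: "tm \<Rightarrow> tm \<Rightarrow> fm" where "Less s t \<equiv> Le (suc s) t"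

fun wff :: "fm \<Rightarrow> bool" where
  "wff Bot = True"
| "wff (Eq s t) = (wt s \<and> wt t \<and> ty_of s = N \<and> ty_of t = N)"
| "wff (p \<^bold>\<longrightarrow> q) = (wff p \<and> wff q)"
| "wff (Forall x p) = wff p"

fun qf :: "fm \<Rightarrow> bool" where
  "qf Bot = True"
| "qf (Eq s t) = True"
| "qf (p \<^bold>\<longrightarrow> q) = (qf p \<and> qf q)"
| "qf (Forall x p) = False"

fun fv :: "fm \<Rightarrow> var set" where
  "fv Bot = {}"
| "fv (Eq s t) = fv_tm s \<union> fv_tm t"
| "fv (p \<^bold>\<longrightarrow> q) = fv p \<union> fv q"
| "fv (Forall x p) = fv p - {x}"

text \<open>Simultaneous substitution; bound variables are not renamed, see \<open>free_for\<close>.\<close>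

fun subst :: "(var \<Rightarrow> tm) \<Rightarrow> fm \<Rightarrow> fm" where
  "subst \<theta> Bot = Bot"
| "subst \<theta> (Eq s t) = Eq (subst_tm \<theta> s) (subst_tm \<theta> t)"
| "subst \<theta> (p \<^bold>\<longrightarrow> q) = subst \<theta> p \<^bold>\<longrightarrow> subst \<theta> q"
| "subst \<theta> (Forall x p) = Forall x (subst (\<theta>(x := V x)) p)"

abbreviation subst1 :: "var \<Rightarrow> tm \<Rightarrow> fm \<Rightarrow> fm" where "subst1 x t p \<equiv> subst (V(x := t)) p"

definition subst_list :: "var list \<Rightarrow> tm list \<Rightarrow> fm \<Rightarrow> fm" where
  "subst_list xs ts p =
     subst (\<lambda>v. case map_of (zip xs ts) v of None \<Rightarrow> V v | Some t \<Rightarrow> t) p"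

fun free_for :: "tm \<Rightarrow> var \<Rightarrow> fm \<Rightarrow> bool" where
  "free_for t x Bot = True"
| "free_for t x (Eq s u) = True"
| "free_for t x (p \<^bold>\<longrightarrow> q) = (free_for t x p \<and> free_for t x q)"
| "free_for t x (Forall y p) = (x \<notin> fv (Forall y p) \<or> (y \<notin> fv_tm t \<and> free_for t x p))"

text \<open>
  Only equality of type 0 is primitive.  Equality of functions is pointwise, equality of sequences
  means equal lengths and equal entries.  In \<open>eq_aux \<sigma> k s t\<close> the index \<open>k\<close> exceeds those of
  all variables of \<open>s\<close> and \<open>t\<close>, so that the bound variables are fresh.
\<close>

fun eq_aux :: "ty \<Rightarrow> nat \<Rightarrow> tm \<Rightarrow> tm \<Rightarrow> fm" where
  "eq_aux N k s t = Eq s t"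
| "eq_aux (\<sigma> \<rightarrow> \<tau>) k s t = Forall (k, \<sigma>) (eq_aux \<tau> (Suc k) (s \<cdot> V (k, \<sigma>)) (t \<cdot> V (k, \<sigma>)))"
| "eq_aux (Seq \<sigma>) k s t =
     Eq (len \<sigma> s) (len \<sigma> t) \<^bold>\<and>
     Forall (k, N) (Less (V (k, N)) (len \<sigma> s) \<^bold>\<longrightarrow>
       eq_aux \<sigma> (Suc k) (ent \<sigma> s (V (k, N))) (ent \<sigma> t (V (k, N))))"

fun fresh_index :: "tm \<Rightarrow> nat" where
  "fresh_index (V x) = Suc (fst x)"
| "fresh_index (C c) = 0"
| "fresh_index (s \<cdot> t) = max (fresh_index s) (fresh_index t)"

definition EqT :: "ty \<Rightarrow> tm \<Rightarrow> tm \<Rightarrow> fm" where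
  "EqT \<sigma> s t = eq_aux \<sigma> (max (fresh_index s) (fresh_index t)) s t"


section \<open>Classical natural deduction\<close>

text \<open>
  \<open>prv Ax \<Gamma> p\<close>: the formula \<open>p\<close> is derivable in the theory with axioms \<open>Ax\<close> from the
  hypotheses \<open>\<Gamma>\<close>.  Free variables of axioms are read universally, so they do not restrict
  the introduction of the universal quantifier.
\<close>

inductive prv :: "fm set \<Rightarrow> fm set \<Rightarrow> fm \<Rightarrow> bool" for Ax :: "fm set" where
  ax: "p \<in> Ax \<Longrightarrow> wff p \<Longrightarrow> prv Ax \<Gamma> p"
| hyp: "p \<in> \<Gamma> \<Longrightarrow> wff p \<Longrightarrow> prv Ax \<Gamma> p"
| impI: "wff p \<Longrightarrow> prv Ax (insert p \<Gamma>) q \<Longrightarrow> prv Ax \<Gamma> (p \<^bold>\<longrightarrow> q)"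
| impE: "prv Ax \<Gamma> (p \<^bold>\<longrightarrow> q) \<Longrightarrow> prv Ax \<Gamma> p \<Longrightarrow> prv Ax \<Gamma> q"
| contr: "wff p \<Longrightarrow> prv Ax (insert (Neg p) \<Gamma>) Bot \<Longrightarrow> prv Ax \<Gamma> p"
| allI: "prv Ax \<Gamma> p \<Longrightarrow> \<forall>q\<in>\<Gamma>. x \<notin> fv q \<Longrightarrow> prv Ax \<Gamma> (Forall x p)"
| allE: "prv Ax \<Gamma> (Forall x p) \<Longrightarrow> wt t \<Longrightarrow> ty_of t = snd x \<Longrightarrow> free_for t x p \<Longrightarrow>
    prv Ax \<Gamma> (subst1 x t p)"

abbreviation provable_in :: "fm set \<Rightarrow> fm \<Rightarrow> bool" (infix "\<turnstile>" 50)
  where "Ax \<turnstile> p \<equiv> prv Ax {} p"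


section \<open>The axioms\<close>

text \<open>
  Ill-typed instances of the schemata below are harmless, as \<open>prv\<close> admits well-formed axioms only.
\<close>

inductive_set EPRA :: "fm set" where
  eq_refl: "Eq s s \<in> EPRA"
| eq_eucl: "Eq s t \<^bold>\<longrightarrow> Eq s u \<^bold>\<longrightarrow> Eq t u \<in> EPRA"
| ext: "EqT \<sigma> s t \<^bold>\<longrightarrow> EqT \<tau> (r \<cdot> s) (r \<cdot> t) \<in> EPRA"
| suc_nonzero: "Neg (Eq (suc s) zero) \<in> EPRA"
| suc_inj: "Eq (suc s) (suc t) \<^bold>\<longrightarrow> Eq s t \<in> EPRA"
| K_ax: "EqT \<sigma> (C (K \<sigma> \<tau>) \<cdot> s \<cdot> t) s \<in> EPRA"
| S_ax: "EqT \<tau> (C (S \<rho> \<sigma> \<tau>) \<cdot> r \<cdot> s \<cdot> t) (r \<cdot> t \<cdot> (s \<cdot> t)) \<in> EPRA"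
| Rec_zero: "Eq (C Rec \<cdot> zero \<cdot> s \<cdot> t) s \<in> EPRA"
| Rec_suc: "Eq (C Rec \<cdot> suc n \<cdot> s \<cdot> t) (t \<cdot> (C Rec \<cdot> n \<cdot> s \<cdot> t) \<cdot> n) \<in> EPRA"
| Len_Tab: "Eq (len \<sigma> (tab \<sigma> f n)) n \<in> EPRA"
| Ent_Tab: "Less i n \<^bold>\<longrightarrow> EqT \<sigma> (ent \<sigma> (tab \<sigma> f n) i) (f \<cdot> i) \<in> EPRA"
| Ent_default: "Le (len \<sigma> s) i \<^bold>\<longrightarrow> EqT \<sigma> (ent \<sigma> s i) (zero_at \<sigma>) \<in> EPRA"
| qf_ind: "qf p \<Longrightarrow> snd x = N \<Longrightarrow>
    subst1 x zero p \<^bold>\<longrightarrow> Forall x (p \<^bold>\<longrightarrow> subst1 x (suc (V x)) p) \<^bold>\<longrightarrow> Forall x p \<in> EPRA"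

definition Forall_list :: "var list \<Rightarrow> fm \<Rightarrow> fm"
  where "Forall_list xs p = foldr Forall xs p"
definition Exists_list :: "var list \<Rightarrow> fm \<Rightarrow> fm"
  where "Exists_list xs p = foldr (\<lambda>x q. Exists x q) xs p"

text \<open>
  Quantifier-free choice for tuples: \<open>xs\<close> ranges over tuples with types in \<open>A\<close>, \<open>ys\<close> over
  tuples with types in \<open>B\<close>; the formula \<open>p\<close> may contain parameters of arbitrary types.
  The choice functions \<open>Fs\<close> take the members of \<open>xs\<close> as successive arguments.
\<close>

definition qf_ac :: "var list \<Rightarrow> var list \<Rightarrow> var list \<Rightarrow> fm \<Rightarrow> fm" where
  "qf_ac xs ys Fs p =
     Forall_list xs (Exists_list ys p) \<^bold>\<longrightarrow>
     Exists_list Fs (Forall_list xs (subst_list ys (map (\<lambda>F. foldl App (V F) (map V xs)) Fs) p))"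

definition qf_ac_vars :: "var list \<Rightarrow> var list \<Rightarrow> var list \<Rightarrow> fm \<Rightarrow> bool" where
  "qf_ac_vars xs ys Fs p \<longleftrightarrow>
     distinct (xs @ ys @ Fs) \<and> set Fs \<inter> fv p = {} \<and>
     map snd Fs = map (\<lambda>y. foldr Fun (map snd xs) (snd y)) ys"

definition QF_AC_tuples :: "ty set \<Rightarrow> ty set \<Rightarrow> fm set" where
  "QF_AC_tuples A B =
     {qf_ac xs ys Fs p | xs ys Fs p.
        qf p \<and> qf_ac_vars xs ys Fs p \<and> snd ` set xs \<subseteq> A \<and> snd ` set ys \<subseteq> B}"

definition QF_AC :: "ty \<Rightarrow> ty \<Rightarrow> fm set" where
  "QF_AC \<rho> \<tau> =
     {qf_ac [x] [y] [F] p | x y F p. qf p \<and> qf_ac_vars [x] [y] [F] p \<and> snd x = \<rho> \<and> snd y = \<tau>}"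

definition RCA0_omega :: "fm set" where
  "RCA0_omega = EPRA \<union> QF_AC (pure_ty 1) (pure_ty 0)"

definition QF_AC_2_1 :: "fm set" where
  "QF_AC_2_1 = QF_AC_tuples {pure_ty 0, pure_ty 1, pure_ty 2} {pure_ty 0, pure_ty 1}"


section \<open>The fan theorem\<close>

text \<open>
  The arguments of the formula schemes below are instantiated only by variables distinct from the
  bound ones.  A finite sequence belongs to \<open>T\<close> iff \<open>T\<close> takes the value 0 at its code.
\<close>

abbreviation In_tree :: "tm \<Rightarrow> tm \<Rightarrow> fm" where
  "In_tree s T \<equiv> Eq (T \<cdot> (code_tm \<cdot> s)) zero"

definition Bin_tree :: "tm \<Rightarrow> fm" where
  "Bin_tree T = (let s = (0, Seq N); n = (1, N); i = (2, N) in
     Forall s (In_tree (V s) T \<^bold>\<longrightarrow>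
       Forall i (Less (V i) (len N (V s)) \<^bold>\<longrightarrow> Le (ent N (V s) (V i)) (suc zero)))
     \<^bold>\<and>
     Forall s (Forall n (Le (V n) (len N (V s)) \<^bold>\<longrightarrow> In_tree (V s) T \<^bold>\<longrightarrow>
       In_tree (tab N (C (Ent N) \<cdot> V s) (V n)) T)))"

definition Binary :: "tm \<Rightarrow> fm" where
  "Binary a = (let n = (0, N) in Forall n (Le (a \<cdot> V n) (suc zero)))"

definition FAN :: fm where
  "FAN = (let T = (0, pure_ty 1); a = (1, pure_ty 1); b = (2, pure_ty 1); n = (3, N); k = (4, N) in
     Forall T (Bin_tree (V T) \<^bold>\<longrightarrow>
       Forall a (Binary (V a) \<^bold>\<longrightarrow> Exists n (Neg (In_tree (tab N (V a) (V n)) (V T)))) \<^bold>\<longrightarrow>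
       Exists k (Forall b (Binary (V b) \<^bold>\<longrightarrow> Neg (In_tree (tab N (V b) (V k)) (V T))))))"

definition FAN_ef :: "tm \<Rightarrow> fm" where
  "FAN_ef h = (let T = (0, pure_ty 1); a = (1, pure_ty 1); b = (2, pure_ty 1); g = (5, pure_ty 2) in
     Forall T (Forall g (Bin_tree (V T) \<^bold>\<longrightarrow>
       Forall a (Binary (V a) \<^bold>\<longrightarrow> Neg (In_tree (tab N (V a) (V g \<cdot> V a)) (V T))) \<^bold>\<longrightarrow>
       Forall b (Binary (V b) \<^bold>\<longrightarrow> Neg (In_tree (tab N (V b) (h \<cdot> V g \<cdot> V T)) (V T))))))"

definition h_var :: var where
  "h_var = (6, pure_ty 2 \<rightarrow> pure_ty 1 \<rightarrow> N)"

end

theory Submission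
  imports Defs "HOL-Library.Countable"
begin

text \<open>
  By completeness it suffices to argue in a model with extensional equality at all types, whose type 0
  may be nonstandard.  There, FAN says that for all \<open>g\<close> and \<open>T\<close> there is a \<open>k\<close> that bounds \<open>T\<close>
  unless \<open>T\<close> is not a tree or \<open>g\<close> fails on some path.  Failure of a premise has a witness of type at
  most 1, and the conclusion that no binary sequence of length \<open>k\<close> is in \<open>T\<close> is equivalent, by a
  primitive recursive search through the numbers below \<open>2 ^ k\<close>, to an equation of type 0.  So one
  instance of QF-AC(2,1) yields \<open>h\<close>.
\<close>

section \<open>Hilbert-style derivations from the empty context\<close>

text \<open>Reasoning in a model replaces long formal derivations in arithmetic by equational
  reasoning. The price is that induction holds there only for quantifier-free formulas, so every
  inductive fact has to name its formula, and existential witnesses have to be given by terms. The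
  choice schema shapes the rest. Its matrix must be quantifier-free, and the objects chosen have
  type 0 or 1. Quantifiers in the premises can be moved to the front as further objects to be
  chosen. The quantifier over binary functions in the conclusion cannot: it is universal and depends
  on \<open>k\<close>, so it would stand behind the existential ones. This is why it must be
  eliminated, and since only finitely many values of a binary function count, a search can do so.
  The search runs through numbers rather than sequences because the only recursor yields values of
  type 0.\<close>

instance ty :: countable by countable_datatype
instance con :: countable by countable_datatype
instance tm :: countable by countable_datatype
instance fm :: countable by countable_datatype

definition typed :: "(var \<Rightarrow> tm) \<Rightarrow> bool" where
  "typed \<theta> \<longleftrightarrow> (\<forall>x. wt (\<theta> x) \<and> ty_of (\<theta> x) = snd x)"

lemma typed_V [simp]: "typed V"
  by (simp add: typed_def)

lemma typed_upd [simp]: "typed \<theta> \<Longrightarrow> wt t \<Longrightarrow> ty_of t = snd x \<Longrightarrow> typed (\<theta>(x := t))"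
  by (cases x) (auto simp: typed_def)

lemma ty_of_subst_tm [simp]: "typed \<theta> \<Longrightarrow> ty_of (subst_tm \<theta> t) = ty_of t"
  by (induction t) (auto simp: typed_def)

lemma wt_subst_tm [simp]: "typed \<theta> \<Longrightarrow> wt t \<Longrightarrow> wt (subst_tm \<theta> t)"
  by (induction t) (auto simp: typed_def)

lemma wff_subst [simp]: "typed \<theta> \<Longrightarrow> wff p \<Longrightarrow> wff (subst \<theta> p)"
  by (induction p arbitrary: \<theta>) auto

lemma subst_tm_V [simp]: "subst_tm V t = t"
  by (induction t) auto

lemma fun_upd_V [simp]: "V(x := V x) = V"
  by auto

lemma subst_V [simp]: "subst V p = p"
  by (induction p) auto

lemma subst_tm_cong: "(\<And>x. x \<in> fv_tm t \<Longrightarrow> \<theta> x = \<theta>' x) \<Longrightarrow> subst_tm \<theta> t = subst_tm \<theta>' t"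
  by (induction t) auto

lemma subst_tm_subst_tm: "subst_tm \<sigma> (subst_tm \<theta> t) = subst_tm (\<lambda>x. subst_tm \<sigma> (\<theta> x)) t"
  by (induction t) auto

lemma fv_subst_tm: "fv_tm (subst_tm \<theta> t) = (\<Union>x\<in>fv_tm t. fv_tm (\<theta> x))"
  by (induction t) auto

lemma fv_subst: "fv (subst \<theta> p) \<subseteq> (\<Union>x\<in>fv p. fv_tm (\<theta> x))"
proof (induction p arbitrary: \<theta>)
  case (Forall x p)
  show ?case using Forall[of "\<theta>(x := V x)"] by (fastforce split: if_splits)
qed (fastforce simp: fv_subst_tm)+

lemma finite_fv_tm [simp]: "finite (fv_tm t)"
  by (induction t) auto

lemma finite_fv [simp]: "finite (fv p)"
  by (induction p) auto

lemma free_for_self [simp]: "free_for (V x) x p"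
  by (induction p) auto

lemma prv_wff: "prv Ax \<Gamma> p \<Longrightarrow> wff p"
  by (induction rule: prv.induct) auto

text \<open>Once K, S and double negation elimination are theorems, later derivations are chains of
  implications without hypotheses. This avoids a weakening rule for hypothesis sets, which would
  have to rename the eigenvariables of \<open>allI\<close>.\<close>

lemma prv_K: "wff p \<Longrightarrow> wff q \<Longrightarrow> Ax \<turnstile> p \<^bold>\<longrightarrow> q \<^bold>\<longrightarrow> p"
  by (intro impI hyp) auto

lemma prv_refl: "wff p \<Longrightarrow> Ax \<turnstile> p \<^bold>\<longrightarrow> p"
  by (intro impI hyp) auto

lemma prv_S:
  assumes "wff p" "wff q" "wff r"
  shows "Ax \<turnstile> (p \<^bold>\<longrightarrow> q \<^bold>\<longrightarrow> r) \<^bold>\<longrightarrow> (p \<^bold>\<longrightarrow> q) \<^bold>\<longrightarrow> p \<^bold>\<longrightarrow> r"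
  by (intro impI, (use assms in simp_all)[3],
      rule impE[where p = q, OF impE[where p = p, OF hyp hyp] impE[where p = p, OF hyp hyp]])
    (use assms in auto)

lemma prv_DN: "wff p \<Longrightarrow> Ax \<turnstile> Neg (Neg p) \<^bold>\<longrightarrow> p"
  by (rule impI, simp, rule contr, simp, rule impE[where p = "Neg p", OF hyp hyp]) auto

lemma prv_weaken: "Ax \<turnstile> q \<Longrightarrow> wff p \<Longrightarrow> Ax \<turnstile> p \<^bold>\<longrightarrow> q"
  using prv_K impE prv_wff by blast

lemma prv_mp_under: "Ax \<turnstile> p \<^bold>\<longrightarrow> q \<^bold>\<longrightarrow> r \<Longrightarrow> Ax \<turnstile> p \<^bold>\<longrightarrow> q \<Longrightarrow> Ax \<turnstile> p \<^bold>\<longrightarrow> r"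
  using prv_S[of p q r Ax] impE prv_wff wff.simps(3) by metis

lemma prv_trans: "Ax \<turnstile> p \<^bold>\<longrightarrow> q \<Longrightarrow> Ax \<turnstile> q \<^bold>\<longrightarrow> r \<Longrightarrow> Ax \<turnstile> p \<^bold>\<longrightarrow> r"
  using prv_mp_under prv_weaken prv_wff wff.simps(3) by metis

lemma prv_imp_mono:
  assumes "Ax \<turnstile> p' \<^bold>\<longrightarrow> p" "Ax \<turnstile> q \<^bold>\<longrightarrow> q'"
  shows "Ax \<turnstile> (p \<^bold>\<longrightarrow> q) \<^bold>\<longrightarrow> p' \<^bold>\<longrightarrow> q'"
proof -
  have w: "wff p" "wff p'" "wff q" "wff q'"
    using assms[THEN prv_wff] by auto
  have "Ax \<turnstile> (p' \<^bold>\<longrightarrow> p) \<^bold>\<longrightarrow> (q \<^bold>\<longrightarrow> q') \<^bold>\<longrightarrow> (p \<^bold>\<longrightarrow> q) \<^bold>\<longrightarrow> p' \<^bold>\<longrightarrow> q'"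
    by (intro impI, (use w in simp_all)[4],
        rule impE[where p = q, OF hyp impE[where p = p, OF hyp impE[where p = p', OF hyp hyp]]])
      (use w in auto)
  then show ?thesis using assms impE by blast
qed

lemma prv_ex_falso: "wff p \<Longrightarrow> wff q \<Longrightarrow> Ax \<turnstile> Neg p \<^bold>\<longrightarrow> p \<^bold>\<longrightarrow> q"
  by (rule impI, simp, rule impI, simp, rule contr, simp, rule impE[where p = p, OF hyp hyp]) auto

lemma prv_allE: "wff (Forall x p) \<Longrightarrow> wt t \<Longrightarrow> ty_of t = snd x \<Longrightarrow> free_for t x p \<Longrightarrow>
    Ax \<turnstile> Forall x p \<^bold>\<longrightarrow> subst1 x t p"
  by (intro impI allE hyp) auto

lemma prv_allE_self: "wff p \<Longrightarrow> Ax \<turnstile> Forall x p \<^bold>\<longrightarrow> p"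
  using prv_allE[of x p "V x" Ax] by simp

lemma prv_allI_under:
  assumes "Ax \<turnstile> p \<^bold>\<longrightarrow> q" "x \<notin> fv p"
  shows "Ax \<turnstile> p \<^bold>\<longrightarrow> Forall x q"
proof -
  have w: "wff p" "wff q" using assms(1)[THEN prv_wff] by auto
  \<comment> \<open>The derivation of the implication cannot be moved under the hypothesis
    \<open>p\<close> without weakening. Its generalization, in which \<open>x\<close> is not free,
    therefore becomes a second hypothesis.\<close>
  let ?\<Gamma> = "{p, Forall x (p \<^bold>\<longrightarrow> q)}"
  have "prv Ax ?\<Gamma> (Forall x (p \<^bold>\<longrightarrow> q))" by (rule hyp) (use w in auto)
  then have "prv Ax ?\<Gamma> (p \<^bold>\<longrightarrow> q)" using allE[of Ax ?\<Gamma> x "p \<^bold>\<longrightarrow> q" "V x"] by simp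
  moreover have "prv Ax ?\<Gamma> p" by (rule hyp) (use w in auto)
  ultimately have "prv Ax ?\<Gamma> q" by (rule impE)
  then have "prv Ax ?\<Gamma> (Forall x q)" by (rule allI) (use assms(2) in auto)
  then have "Ax \<turnstile> Forall x (p \<^bold>\<longrightarrow> q) \<^bold>\<longrightarrow> p \<^bold>\<longrightarrow> Forall x q" by (intro impI) (use w in auto)
  moreover have "Ax \<turnstile> Forall x (p \<^bold>\<longrightarrow> q)" by (rule allI) (use assms in auto)
  ultimately show ?thesis by (rule impE)
qed

lemma prv_Forall_list: "Ax \<turnstile> p \<Longrightarrow> Ax \<turnstile> Forall_list xs p"
  by (induction xs) (auto simp: Forall_list_def intro: allI)

section \<open>Substitution with renaming of bound variables\<close>

text \<open>\<open>subst\<close> does not rename bound variables.  Here the binder at nesting depth \<open>d\<close> becomes \<open>k + d\<close>,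
  so that no clash occurs for suitable \<open>k\<close>; up to provable equivalence the choice of \<open>k\<close> is
  irrelevant (\<open>prv_csub_csub\<close>).\<close>

fun csub :: "nat \<Rightarrow> (var \<Rightarrow> tm) \<Rightarrow> fm \<Rightarrow> fm" where
  "csub k \<theta> Bot = Bot"
| "csub k \<theta> (Eq s t) = Eq (subst_tm \<theta> s) (subst_tm \<theta> t)"
| "csub k \<theta> (p \<^bold>\<longrightarrow> q) = csub k \<theta> p \<^bold>\<longrightarrow> csub k \<theta> q"
| "csub k \<theta> (Forall x p) = Forall (k, snd x) (csub (Suc k) (\<theta>(x := V (k, snd x))) p)"

fun depth :: "fm \<Rightarrow> nat" where
  "depth Bot = 0"
| "depth (Eq s t) = 0"
| "depth (p \<^bold>\<longrightarrow> q) = max (depth p) (depth q)"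
| "depth (Forall x p) = Suc (depth p)"

definition no_clash :: "nat \<Rightarrow> (var \<Rightarrow> tm) \<Rightarrow> fm \<Rightarrow> bool" where
  "no_clash k \<theta> p \<longleftrightarrow> (\<forall>z\<in>fv p. \<forall>v\<in>fv_tm (\<theta> z). fst v < k \<or> k + depth p \<le> fst v)"

lemma no_clash_Imp: "no_clash k \<theta> (p \<^bold>\<longrightarrow> q) \<Longrightarrow> no_clash k \<theta> p \<and> no_clash k \<theta> q"
  by (fastforce simp: no_clash_def)

lemma no_clash_Forall:
  assumes "no_clash k \<theta> (Forall x p)"
  shows "no_clash (Suc k) (\<theta>(x := V (k, s))) p"
  using assms by (fastforce simp: no_clash_def)

lemma no_clash_below: "\<forall>z\<in>fv p. \<forall>v\<in>fv_tm (\<theta> z). fst v < k \<Longrightarrow> no_clash k \<theta> p"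
  by (auto simp: no_clash_def)

lemma obtain_bound:
  fixes A :: "var set"
  assumes "finite A"
  obtains j where "\<forall>v\<in>A. fst v < j" "k \<le> j"
proof -
  obtain m where "\<forall>n\<in>fst ` A. n < m"
    using assms finite_nat_set_iff_bounded by blast
  then show thesis by (intro that[of "max m k"]) auto
qed

lemma csub_cong: "(\<And>z. z \<in> fv p \<Longrightarrow> \<theta> z = \<theta>' z) \<Longrightarrow> csub k \<theta> p = csub k \<theta>' p"
proof (induction p arbitrary: k \<theta> \<theta>')
  case (Eq s t)
  have "subst_tm \<theta> s = subst_tm \<theta>' s" "subst_tm \<theta> t = subst_tm \<theta>' t"
    by (rule subst_tm_cong, simp add: Eq)+
  then show ?case by simp
next
  case (Imp p q)
  have "csub k \<theta> p = csub k \<theta>' p" "csub k \<theta> q = csub k \<theta>' q"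
    by (rule Imp.IH, simp add: Imp.prems)+
  then show ?case by simp
next
  case (Forall x p)
  have "csub (Suc k) (\<theta>(x := V (k, snd x))) p = csub (Suc k) (\<theta>'(x := V (k, snd x))) p"
    by (rule Forall.IH) (simp add: Forall.prems)
  then show ?case by simp
qed auto

lemma wff_csub [simp]: "typed \<theta> \<Longrightarrow> wff p \<Longrightarrow> wff (csub k \<theta> p)"
  by (induction p arbitrary: k \<theta>) auto

lemma fv_csub: "fv (csub k \<theta> p) \<subseteq> (\<Union>x\<in>fv p. fv_tm (\<theta> x))"
proof (induction p arbitrary: k \<theta>)
  case (Forall x p)
  show ?case using Forall[of "Suc k" "\<theta>(x := V (k, snd x))"] by (fastforce split: if_splits)
qed (fastforce simp: fv_subst_tm)+

text \<open>No image of a free variable contains a binder of the renamed formula, so the outer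
  substitution acts on the images alone.\<close>

lemma subst_csub:
  "no_clash k \<theta> p \<Longrightarrow> subst \<sigma> (csub k \<theta> p) = csub k (\<lambda>z. subst_tm \<sigma> (\<theta> z)) p"
proof (induction p arbitrary: k \<theta> \<sigma>)
  case (Imp p q)
  then show ?case using no_clash_Imp[OF Imp.prems] by simp
next
  case (Forall x p)
  have "csub (Suc k) (\<lambda>z. subst_tm (\<sigma>((k, snd x) := V (k, snd x))) ((\<theta>(x := V (k, snd x))) z)) p =
    csub (Suc k) ((\<lambda>z. subst_tm \<sigma> (\<theta> z))(x := V (k, snd x))) p"
  proof (rule csub_cong)
    fix z assume "z \<in> fv p"
    then have "z \<noteq> x \<Longrightarrow> (k, snd x) \<notin> fv_tm (\<theta> z)"
      using Forall.prems by (force simp: no_clash_def)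
    then have "z \<noteq> x \<Longrightarrow> subst_tm (\<sigma>((k, snd x) := V (k, snd x))) (\<theta> z) = subst_tm \<sigma> (\<theta> z)"
      by (intro subst_tm_cong) (metis fun_upd_other)
    then show "subst_tm (\<sigma>((k, snd x) := V (k, snd x))) ((\<theta>(x := V (k, snd x))) z) =
        ((\<lambda>z. subst_tm \<sigma> (\<theta> z))(x := V (k, snd x))) z" by simp
  qed
  with Forall.IH[OF no_clash_Forall[OF Forall.prems]] show ?case
    by (simp only: csub.simps subst.simps)
qed (auto simp: subst_tm_subst_tm)

lemma free_for_csub:
  "\<forall>v\<in>fv_tm t. fst v < k \<or> k + depth p \<le> fst v \<Longrightarrow> free_for t x (csub k \<theta> p)"
proof (induction p arbitrary: k \<theta>)
  case (Forall y p)
  have "(k, snd y) \<notin> fv_tm t" using Forall.prems by force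
  moreover have "\<forall>v\<in>fv_tm t. fst v < Suc k \<or> Suc k + depth p \<le> fst v"
    using Forall.prems by force
  ultimately show ?case using Forall.IH by simp
qed fastforce+

text \<open>The outer binder \<open>y\<close> is not tied to the numbering: any index below
  \<open>j\<close> will do if \<open>y\<close> avoids the other images. It can thus be a renamed
  binder or the original variable, and \<open>prv_csub_V\<close> needs both.\<close>

lemma csub_instance:
  assumes "\<forall>z\<in>fv p - {x}. \<forall>v\<in>fv_tm (\<theta> z). fst v < j"
    and "\<forall>z\<in>fv p - {x}. y \<notin> fv_tm (\<theta> z)" "fst y < j" "snd y = snd x"
    and "\<forall>v\<in>fv_tm t. fst v < j" "wt t" "ty_of t = snd x" "typed \<theta>" "wff p"
  shows "Ax \<turnstile> Forall y (csub j (\<theta>(x := V y)) p) \<^bold>\<longrightarrow> csub j (\<theta>(x := t)) p"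
proof -
  have "no_clash j (\<theta>(x := V y)) p" using assms(1,3) by (fastforce simp: no_clash_def split: if_splits)
  then have "subst1 y t (csub j (\<theta>(x := V y)) p) =
      csub j (\<lambda>z. subst_tm (V(y := t)) ((\<theta>(x := V y)) z)) p"
    by (rule subst_csub)
  also have "\<dots> = csub j (\<theta>(x := t)) p"
  proof (rule csub_cong)
    fix z assume "z \<in> fv p"
    then have "subst_tm (V(y := t)) (\<theta> z) = \<theta> z" if "z \<noteq> x"
    proof -
      have "subst_tm (V(y := t)) (\<theta> z) = subst_tm V (\<theta> z)"
      proof (rule subst_tm_cong)
        fix v assume "v \<in> fv_tm (\<theta> z)"
        then have "v \<noteq> y" using assms(2) that \<open>z \<in> fv p\<close> by blast
        then show "(V(y := t)) v = V v" by simp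
      qed
      then show ?thesis by simp
    qed
    then show "subst_tm (V(y := t)) ((\<theta>(x := V y)) z) = (\<theta>(x := t)) z" by auto
  qed
  finally show ?thesis
    using prv_allE[of y "csub j (\<theta>(x := V y)) p" t Ax] free_for_csub[of t j p y] assms by simp
qed

text \<open>This is alpha-equivalence of two renamings. They are compared through a third numbering
  that starts at \<open>j\<close>, beyond \<open>k\<close>, \<open>k'\<close> and all variables of
  the images.\<close>

lemma prv_csub_csub:
  "no_clash k \<theta> p \<Longrightarrow> no_clash k' \<theta> p \<Longrightarrow> typed \<theta> \<Longrightarrow> wff p \<Longrightarrow> Ax \<turnstile> csub k \<theta> p \<^bold>\<longrightarrow> csub k' \<theta> p"
proof (induction p arbitrary: k k' \<theta>)
  case (Imp p q)
  have "Ax \<turnstile> csub k' \<theta> p \<^bold>\<longrightarrow> csub k \<theta> p" "Ax \<turnstile> csub k \<theta> q \<^bold>\<longrightarrow> csub k' \<theta> q"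
    using Imp.IH Imp.prems no_clash_Imp[OF Imp.prems(1)] no_clash_Imp[OF Imp.prems(2)] by simp_all
  then show ?case by (simp add: prv_imp_mono)
next
  case (Forall x p)
  let ?y = "(k, snd x)" and ?y' = "(k', snd x)"
  let ?A = "csub (Suc k) (\<theta>(x := V ?y)) p"
  have "finite (\<Union>z\<in>fv p. fv_tm (\<theta> z))" by simp
  then obtain j where j: "\<forall>v\<in>(\<Union>z\<in>fv p. fv_tm (\<theta> z)). fst v < j" "Suc (max k k') \<le> j"
    by (rule obtain_bound)
  have ok: "no_clash j (\<theta>(x := V ?y)) p" "no_clash j (\<theta>(x := V ?y')) p"
    by (rule no_clash_below; use j in auto)+
  have fvA: "fv (Forall ?y ?A) \<subseteq> (\<Union>z\<in>fv p - {x}. fv_tm (\<theta> z))"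
    using fv_csub[of k \<theta> "Forall x p"] by simp
  have nc: "no_clash (Suc k) (\<theta>(x := V ?y)) p" "no_clash (Suc k') (\<theta>(x := V ?y')) p"
    using Forall.prems(1,2)[THEN no_clash_Forall] by blast+
  have w: "typed (\<theta>(x := V ?y))" "typed (\<theta>(x := V ?y'))" "wff p"
    using Forall.prems by simp_all
  have "Ax \<turnstile> ?A \<^bold>\<longrightarrow> csub j (\<theta>(x := V ?y)) p"
    by (rule Forall.IH[OF nc(1) ok(1) w(1,3)])
  then have "Ax \<turnstile> Forall ?y ?A \<^bold>\<longrightarrow> csub j (\<theta>(x := V ?y)) p"
    using prv_trans[OF prv_allE_self] w(1,3) by simp
  then have "Ax \<turnstile> Forall ?y ?A \<^bold>\<longrightarrow> Forall ?y (csub j (\<theta>(x := V ?y)) p)"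
    by (rule prv_allI_under) simp
  moreover have "Ax \<turnstile> Forall ?y (csub j (\<theta>(x := V ?y)) p) \<^bold>\<longrightarrow> csub j (\<theta>(x := V ?y')) p"
  proof (rule csub_instance)
    show "\<forall>z\<in>fv p - {x}. ?y \<notin> fv_tm (\<theta> z)"
      using Forall.prems(1) by (force simp: no_clash_def)
  qed (use j Forall.prems in auto)
  moreover have "Ax \<turnstile> csub j (\<theta>(x := V ?y')) p \<^bold>\<longrightarrow> csub (Suc k') (\<theta>(x := V ?y')) p"
    by (rule Forall.IH[OF ok(2) nc(2) w(2,3)])
  ultimately have "Ax \<turnstile> Forall ?y ?A \<^bold>\<longrightarrow> csub (Suc k') (\<theta>(x := V ?y')) p"
    using prv_trans by blast
  moreover have "?y' \<notin> fv (Forall ?y ?A)"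
    using fvA Forall.prems(2) by (fastforce simp: no_clash_def)
  ultimately show ?case using prv_allI_under by simp
qed (auto simp: prv_refl)

lemma prv_csub_V:
  assumes "wff p" "\<forall>v\<in>fv p. fst v < k"
  shows "Ax \<turnstile> csub k V p \<^bold>\<longrightarrow> p \<and> Ax \<turnstile> p \<^bold>\<longrightarrow> csub k V p"
  using assms
proof (induction p arbitrary: k)
  case (Imp p q)
  then show ?case by (simp add: prv_imp_mono)
next
  case (Forall x p)
  \<comment> \<open>The variable \<open>x\<close> may itself have an index above \<open>k\<close>,
    so the induction hypothesis is applied beyond \<open>x\<close> and the result is moved back to
    \<open>k\<close>.\<close>
  obtain j where j: "\<forall>v\<in>insert x (fv p). fst v < j" "k \<le> j"
    by (rule obtain_bound[of "insert x (fv p)" k]) auto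
  let ?y = "(j, snd x)"
  have w: "wff p" using Forall.prems by simp
  have "\<forall>v\<in>fv p. fst v < Suc j" using j by auto
  with Forall.IH w have IH: "Ax \<turnstile> csub (Suc j) V p \<^bold>\<longrightarrow> p" "Ax \<turnstile> p \<^bold>\<longrightarrow> csub (Suc j) V p"
    by blast+
  have nc: "no_clash k V (Forall x p)" "no_clash j V (Forall x p)"
    using Forall.prems j by (auto simp: no_clash_def)
  have eq: "Ax \<turnstile> csub k V (Forall x p) \<^bold>\<longrightarrow> csub j V (Forall x p)"
    "Ax \<turnstile> csub j V (Forall x p) \<^bold>\<longrightarrow> csub k V (Forall x p)"
    using prv_csub_csub nc Forall.prems(1) typed_V by blast+
  have y: "\<forall>z\<in>fv p - {x}. ?y \<notin> fv_tm (V z)" using j by auto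
  have below: "\<forall>z\<in>fv p - {x}. \<forall>v\<in>fv_tm (V z). fst v < Suc j" using j by auto
  have "Ax \<turnstile> csub j V (Forall x p) \<^bold>\<longrightarrow> csub (Suc j) (V(x := V x)) p"
    unfolding csub.simps by (rule csub_instance[OF below y]) (use j w in auto)
  then have "Ax \<turnstile> csub j V (Forall x p) \<^bold>\<longrightarrow> csub (Suc j) V p" by (simp only: fun_upd_V)
  then have "Ax \<turnstile> csub k V (Forall x p) \<^bold>\<longrightarrow> p"
    using prv_trans[OF prv_trans[OF eq(1)] IH(1)] by blast
  moreover have "x \<notin> fv (csub k V (Forall x p))"
    using fv_csub[of k V "Forall x p"] by auto
  ultimately have 1: "Ax \<turnstile> csub k V (Forall x p) \<^bold>\<longrightarrow> Forall x p"
    by (rule prv_allI_under)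
  have "Ax \<turnstile> Forall x p \<^bold>\<longrightarrow> csub (Suc j) V p"
    by (rule prv_trans[OF prv_allE_self[OF w] IH(2)])
  then have "Ax \<turnstile> Forall x p \<^bold>\<longrightarrow> Forall x (csub (Suc j) V p)"
    by (rule prv_allI_under) simp
  moreover have "Ax \<turnstile> Forall x (csub (Suc j) (V(x := V x)) p) \<^bold>\<longrightarrow> csub (Suc j) (V(x := V ?y)) p"
    by (rule csub_instance[OF below]) (use j w in auto)
  ultimately have "Ax \<turnstile> Forall x p \<^bold>\<longrightarrow> csub (Suc j) (V(x := V ?y)) p"
    using prv_trans by (simp only: fun_upd_V)
  moreover have "?y \<notin> fv (Forall x p)" using j by auto
  ultimately have "Ax \<turnstile> Forall x p \<^bold>\<longrightarrow> csub j V (Forall x p)"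
    by (simp only: csub.simps prv_allI_under not_False_eq_True)
  then have "Ax \<turnstile> Forall x p \<^bold>\<longrightarrow> csub k V (Forall x p)"
    using eq(2) by (rule prv_trans)
  with 1 show ?case ..
qed (auto simp: prv_refl)

section \<open>Henkin sets\<close>

fun bnd :: "fm \<Rightarrow> nat" where
  "bnd Bot = 0"
| "bnd (Eq s t) = max (fresh_index s) (fresh_index t)"
| "bnd (p \<^bold>\<longrightarrow> q) = max (bnd p) (bnd q)"
| "bnd (Forall x p) = max (Suc (fst x)) (bnd p)"

lemma fresh_index_fv_tm: "v \<in> fv_tm t \<Longrightarrow> fst v < fresh_index t"
  by (induction t) auto

lemma bnd_fv: "v \<in> fv p \<Longrightarrow> fst v < bnd p"
  by (induction p) (auto dest: fresh_index_fv_tm)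

text \<open>Unlike \<open>fv\<close>, \<open>bnd\<close> also counts bound variables, so it exceeds
  every binder index created by \<open>csub\<close>. A witness beyond \<open>bnd\<close> hence lies
  above the interval that \<open>no_clash\<close> excludes.\<close>

lemma depth_le_bnd_csub: "k + depth p \<le> max k (bnd (csub k \<theta> p))"
proof (induction p arbitrary: k \<theta>)
  case (Imp p q)
  show ?case using Imp(1)[of k \<theta>] Imp(2)[of k \<theta>] by auto
next
  case (Forall x p)
  show ?case using Forall[of "Suc k" "\<theta>(x := V (k, snd x))"] by (simp del: fun_upd_apply)
qed auto

lemma subst_cong: "(\<And>x. x \<in> fv p \<Longrightarrow> \<theta> x = \<theta>' x) \<Longrightarrow> subst \<theta> p = subst \<theta>' p"
proof (induction p arbitrary: \<theta> \<theta>')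
  case (Eq s t)
  have "subst_tm \<theta> s = subst_tm \<theta>' s" "subst_tm \<theta> t = subst_tm \<theta>' t"
    by (rule subst_tm_cong, simp add: Eq)+
  then show ?case by simp
next
  case (Imp p q)
  have "subst \<theta> p = subst \<theta>' p" "subst \<theta> q = subst \<theta>' q"
    by (rule Imp.IH, simp add: Imp.prems)+
  then show ?case by simp
next
  case (Forall x p)
  have "subst (\<theta>(x := V x)) p = subst (\<theta>'(x := V x)) p"
    by (rule Forall.IH) (simp add: Forall.prems)
  then show ?case by simp
qed auto

lemma subst_tm_unused: "v \<notin> fv_tm t \<Longrightarrow> subst_tm (V(v := s)) t = t"
  using subst_tm_cong[of t "V(v := s)" V] by (metis fun_upd_other subst_tm_V)

lemma subst1_unused: "v \<notin> fv p \<Longrightarrow> subst1 v s p = p"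
  using subst_cong[of p "V(v := s)" V] by (metis fun_upd_other subst_V)

lemma subst_tm_rename_back: "y \<notin> fv_tm t \<Longrightarrow> subst_tm (V(y := V x)) (subst_tm (V(x := V y)) t) = t"
  by (induction t) auto

lemma rename_back:
  assumes "bnd p \<le> fst y" "x \<noteq> y"
  shows "subst1 y (V x) (subst1 x (V y) p) = p \<and> free_for (V x) y (subst1 x (V y) p)"
  using assms(1)
proof (induction p)
  case (Eq s t)
  then have "y \<notin> fv_tm s" "y \<notin> fv_tm t"
    using fresh_index_fv_tm[of y s] fresh_index_fv_tm[of y t] by auto
  then show ?case by (simp add: subst_tm_rename_back del: fun_upd_apply)
next
  case (Forall z p)
  then have zy: "z \<noteq> y" and y: "y \<notin> fv p" using bnd_fv[of y p] by auto
  show ?case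
  proof (cases "z = x")
    case True
    have eq: "(V(x := V y))(x := V x) = V" "(V(y := V x))(x := V x) = V(y := V x)"
      using assms(2) by auto
    from True y assms(2) show ?thesis
      by (simp add: eq subst1_unused del: fun_upd_apply fun_upd_upd)
  next
    case False
    with zy have eq: "(V(x := V y))(z := V z) = V(x := V y)" "(V(y := V x))(z := V z) = V(y := V x)"
      by auto
    have "subst1 y (V x) (subst1 x (V y) p) = p" "free_for (V x) y (subst1 x (V y) p)"
      using Forall.IH Forall.prems by (simp_all del: fun_upd_apply)
    with False show ?thesis by (simp add: eq del: fun_upd_apply)
  qed
qed auto

lemma prv_rename:
  assumes "wff p" "bnd (Forall x p) \<le> fst y" "snd y = snd x"
  shows "Ax \<turnstile> Forall y (subst1 x (V y) p) \<^bold>\<longrightarrow> Forall x p"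
proof -
  have ne: "x \<noteq> y" and b: "bnd p \<le> fst y" using assms(2) by auto
  have "Ax \<turnstile> Forall y (subst1 x (V y) p) \<^bold>\<longrightarrow> subst1 y (V x) (subst1 x (V y) p)"
    using rename_back[OF b ne] assms by (intro prv_allE) auto
  then have "Ax \<turnstile> Forall y (subst1 x (V y) p) \<^bold>\<longrightarrow> p"
    using rename_back[OF b ne] by simp
  moreover have "x \<notin> fv (Forall y (subst1 x (V y) p))"
    using fv_subst[of "V(x := V y)" p] ne by (force split: if_splits)
  ultimately show ?thesis by (rule prv_allI_under)
qed

section \<open>Consistency and the Henkin construction\<close>

lemma prv_Neg_Imp_left: "wff p \<Longrightarrow> wff q \<Longrightarrow> Ax \<turnstile> Neg (p \<^bold>\<longrightarrow> q) \<^bold>\<longrightarrow> p"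
  by (rule impI, simp, rule contr, simp, rule impE[where p = "p \<^bold>\<longrightarrow> q", OF hyp], simp, simp,
      rule impI, simp, rule contr, simp, rule impE[where p = p, OF hyp hyp]) auto

lemma prv_Neg_Imp_right: "wff p \<Longrightarrow> wff q \<Longrightarrow> Ax \<turnstile> Neg (p \<^bold>\<longrightarrow> q) \<^bold>\<longrightarrow> Neg q"
  by (rule impI, simp, rule impI, simp, rule impE[where p = "p \<^bold>\<longrightarrow> q", OF hyp], simp, simp,
      rule impI, simp, rule hyp) auto

lemma prv_Conj_left: "wff p \<Longrightarrow> wff q \<Longrightarrow> Ax \<turnstile> p \<^bold>\<and> q \<^bold>\<longrightarrow> p"
  by (rule prv_Neg_Imp_left) auto

lemma prv_Conj_right: "wff p \<Longrightarrow> wff q \<Longrightarrow> Ax \<turnstile> p \<^bold>\<and> q \<^bold>\<longrightarrow> q"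
  by (rule prv_trans[OF prv_Neg_Imp_right prv_DN]) auto

text \<open>A single formula represents the finite set accepted so far. It has finitely many
  variables, so fresh witnesses are found among the variables of the language, without new
  constants.\<close>

definition consis :: "fm set \<Rightarrow> fm \<Rightarrow> bool" where
  "consis Ax c \<longleftrightarrow> wff c \<and> \<not> Ax \<turnstile> Neg c"

lemma consis_Conj: "wff c \<Longrightarrow> wff p \<Longrightarrow> \<not> Ax \<turnstile> c \<^bold>\<longrightarrow> Neg p \<Longrightarrow> consis Ax (c \<^bold>\<and> p)"
  using impE[OF prv_DN[of "c \<^bold>\<longrightarrow> Neg p" Ax]] by (auto simp: consis_def)

fun henkin_axiom :: "fm \<Rightarrow> fm \<Rightarrow> fm" where
  "henkin_axiom c (Forall x p) =
     subst1 x (V (max (bnd c) (bnd (Forall x p)), snd x)) p \<^bold>\<longrightarrow> Forall x p"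
| "henkin_axiom c p = Neg Bot"

lemma wff_henkin_axiom: "wff p \<Longrightarrow> wff (henkin_axiom c p)"
  by (cases p) auto

text \<open>If \<open>c\<close> refuted the axiom, it would prove the instance at the witness and
  refute the universal formula. The witness is not free in \<open>c\<close>, so the instance
  generalizes and \<open>c\<close> is inconsistent.\<close>

lemma consis_henkin_axiom:
  assumes c: "consis Ax c" and p: "wff p"
  shows "consis Ax (c \<^bold>\<and> henkin_axiom c p)"
proof (rule consis_Conj)
  show "wff c" "wff (henkin_axiom c p)"
    using assms wff_henkin_axiom by (auto simp: consis_def)
  show "\<not> Ax \<turnstile> c \<^bold>\<longrightarrow> Neg (henkin_axiom c p)"
  proof
    assume *: "Ax \<turnstile> c \<^bold>\<longrightarrow> Neg (henkin_axiom c p)"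
    have "Ax \<turnstile> Neg c"
    proof (cases "\<exists>x q. p = Forall x q")
      case True
      then obtain x q where p_eq: "p = Forall x q" by auto
      define y where "y = (max (bnd c) (bnd (Forall x q)), snd x)"
      let ?A = "subst1 x (V y) q"
      have w: "wff ?A" "wff p" using p p_eq y_def by auto
      have h: "henkin_axiom c p = ?A \<^bold>\<longrightarrow> p" by (simp add: p_eq y_def)
      have "Ax \<turnstile> c \<^bold>\<longrightarrow> ?A"
        using prv_trans[OF * [unfolded h] prv_Neg_Imp_left[OF w]] .
      then have "Ax \<turnstile> c \<^bold>\<longrightarrow> Forall y ?A"
        by (rule prv_allI_under) (use bnd_fv[of y c] in \<open>auto simp: y_def\<close>)
      moreover have "Ax \<turnstile> Forall y ?A \<^bold>\<longrightarrow> p"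
        unfolding p_eq by (rule prv_rename) (use w p_eq in \<open>auto simp: y_def\<close>)
      ultimately have "Ax \<turnstile> c \<^bold>\<longrightarrow> p" by (rule prv_trans)
      moreover have "Ax \<turnstile> c \<^bold>\<longrightarrow> Neg p"
        using prv_trans[OF * [unfolded h] prv_Neg_Imp_right[OF w]] .
      ultimately show ?thesis by (rule prv_mp_under[rotated])
    next
      case False
      then have "henkin_axiom c p = Neg Bot" by (cases p) auto
      with * have "Ax \<turnstile> c \<^bold>\<longrightarrow> Neg Bot \<^bold>\<longrightarrow> Bot" by simp
      moreover have "Ax \<turnstile> c \<^bold>\<longrightarrow> Neg Bot"
        using c by (auto simp: consis_def intro!: prv_weaken prv_refl)
      ultimately show ?thesis by (rule prv_mp_under)
    qed
    with c show False by (simp add: consis_def)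
  qed
qed

definition extend :: "fm set \<Rightarrow> fm \<Rightarrow> fm \<Rightarrow> fm" where
  "extend Ax c p = (let c' = c \<^bold>\<and> henkin_axiom c p in if Ax \<turnstile> c' \<^bold>\<longrightarrow> Neg p then c' else c' \<^bold>\<and> p)"

lemma extend:
  assumes "consis Ax c" "wff p"
  shows "consis Ax (extend Ax c p)" "Ax \<turnstile> extend Ax c p \<^bold>\<longrightarrow> c"
    "Ax \<turnstile> extend Ax c p \<^bold>\<longrightarrow> henkin_axiom c p"
    "Ax \<turnstile> extend Ax c p \<^bold>\<longrightarrow> p \<or> Ax \<turnstile> extend Ax c p \<^bold>\<longrightarrow> Neg p"
proof -
  let ?c = "c \<^bold>\<and> henkin_axiom c p"
  have w: "wff c" "wff (henkin_axiom c p)" "wff p" "wff ?c"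
    using assms wff_henkin_axiom by (auto simp: consis_def)
  have c': "consis Ax ?c" by (rule consis_henkin_axiom[OF assms])
  have l: "Ax \<turnstile> ?c \<^bold>\<longrightarrow> c" "Ax \<turnstile> ?c \<^bold>\<longrightarrow> henkin_axiom c p"
    using prv_Conj_left prv_Conj_right w by blast+
  have e: "Ax \<turnstile> extend Ax c p \<^bold>\<longrightarrow> ?c"
    using prv_refl[OF w(4)] prv_Conj_left[OF w(4,3)] by (simp add: extend_def Let_def)
  show "consis Ax (extend Ax c p)"
    using c' consis_Conj[OF w(4,3)] by (simp add: extend_def Let_def)
  show "Ax \<turnstile> extend Ax c p \<^bold>\<longrightarrow> c" "Ax \<turnstile> extend Ax c p \<^bold>\<longrightarrow> henkin_axiom c p"
    using prv_trans[OF e l(1)] prv_trans[OF e l(2)] .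
  show "Ax \<turnstile> extend Ax c p \<^bold>\<longrightarrow> p \<or> Ax \<turnstile> extend Ax c p \<^bold>\<longrightarrow> Neg p"
    using prv_Conj_right[OF w(4,3)] by (simp add: extend_def Let_def)
qed

fun stage :: "fm set \<Rightarrow> fm \<Rightarrow> nat \<Rightarrow> fm" where
  "stage Ax c 0 = c"
| "stage Ax c (Suc n) =
     (if wff (from_nat n) then extend Ax (stage Ax c n) (from_nat n) else stage Ax c n)"

lemma consis_stage: "consis Ax c \<Longrightarrow> consis Ax (stage Ax c n)"
  by (induction n) (auto intro: extend)

lemma stage_mono: "m \<le> n \<Longrightarrow> consis Ax c \<Longrightarrow> Ax \<turnstile> stage Ax c n \<^bold>\<longrightarrow> stage Ax c m"
proof (induction n rule: dec_induct)
  case base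
  then show ?case using consis_stage prv_refl unfolding consis_def by blast
next
  case (step n)
  then have "Ax \<turnstile> stage Ax c (Suc n) \<^bold>\<longrightarrow> stage Ax c n"
    using extend(2) consis_stage prv_refl unfolding consis_def stage.simps by metis
  with step show ?case using prv_trans by blast
qed

text \<open>The index of \<open>y\<close> is bounded from below because the truth lemma substitutes
  \<open>y\<close> under binders whose names are already fixed.\<close>

definition henkin_set :: "fm set \<Rightarrow> fm set \<Rightarrow> bool" where
  "henkin_set Ax M \<longleftrightarrow>
     (\<forall>p. Ax \<turnstile> p \<longrightarrow> p \<in> M) \<and> (\<forall>p q. p \<^bold>\<longrightarrow> q \<in> M \<longrightarrow> p \<in> M \<longrightarrow> q \<in> M) \<and> Bot \<notin> M \<and>
     (\<forall>p. wff p \<longrightarrow> p \<in> M \<or> Neg p \<in> M) \<and>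
     (\<forall>x p. wff p \<longrightarrow> (\<exists>y. snd y = snd x \<and> bnd (Forall x p) \<le> fst y \<and>
        (subst1 x (V y) p \<^bold>\<longrightarrow> Forall x p) \<in> M))"

lemma henkin_set_exists:
  assumes c: "consis Ax c"
  shows "\<exists>M. henkin_set Ax M \<and> c \<in> M"
proof (intro exI conjI)
  let ?s = "stage Ax c"
  \<comment> \<open>Later stages imply earlier ones, which makes this union closed under modus
    ponens; the formula numbered \<open>n\<close> is decided at stage \<open>Suc n\<close>.\<close>
  let ?M = "{p. \<exists>n. Ax \<turnstile> ?s n \<^bold>\<longrightarrow> p}"
  have w: "wff (?s n)" for n using consis_stage[OF c] by (simp add: consis_def)
  have decide: "Ax \<turnstile> ?s (Suc (to_nat p)) \<^bold>\<longrightarrow> henkin_axiom (?s (to_nat p)) p \<and>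
      (Ax \<turnstile> ?s (Suc (to_nat p)) \<^bold>\<longrightarrow> p \<or> Ax \<turnstile> ?s (Suc (to_nat p)) \<^bold>\<longrightarrow> Neg p)" if "wff p" for p
    using extend(3,4)[OF consis_stage[OF c] that] that by simp
  show "henkin_set Ax ?M"
    unfolding henkin_set_def
  proof (intro conjI HOL.allI HOL.impI)
    fix p assume "Ax \<turnstile> p"
    then show "p \<in> ?M" using prv_weaken w by blast
  next
    fix p q assume "p \<^bold>\<longrightarrow> q \<in> ?M" "p \<in> ?M"
    then obtain m n where mn: "Ax \<turnstile> ?s m \<^bold>\<longrightarrow> p \<^bold>\<longrightarrow> q" "Ax \<turnstile> ?s n \<^bold>\<longrightarrow> p" by auto
    have "Ax \<turnstile> ?s (max m n) \<^bold>\<longrightarrow> p \<^bold>\<longrightarrow> q" "Ax \<turnstile> ?s (max m n) \<^bold>\<longrightarrow> p"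
      using prv_trans[OF stage_mono[OF _ c] mn(1), of "max m n"]
        prv_trans[OF stage_mono[OF _ c] mn(2), of "max m n"] by simp_all
    then show "q \<in> ?M" using prv_mp_under by blast
  next
    show "Bot \<notin> ?M" using consis_stage[OF c] by (simp add: consis_def)
  next
    fix p assume "wff p"
    then show "p \<in> ?M \<or> Neg p \<in> ?M" using decide by blast
  next
    fix x p assume "wff p"
    let ?p = "Forall x p"
    let ?y = "(max (bnd (?s (to_nat ?p))) (bnd ?p), snd x)"
    have "wff ?p" using \<open>wff p\<close> by simp
    then have "(subst1 x (V ?y) p \<^bold>\<longrightarrow> ?p) \<in> ?M"
      using conjunct1[OF decide[of ?p]] unfolding henkin_axiom.simps by blast
    moreover have "snd ?y = snd x" "bnd ?p \<le> fst ?y" by simp_all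
    ultimately show "\<exists>y. snd y = snd x \<and> bnd ?p \<le> fst y \<and> (subst1 x (V y) p \<^bold>\<longrightarrow> ?p) \<in> ?M" by blast
  qed
  show "c \<in> ?M" using prv_refl[OF w[of 0], of Ax] by (intro CollectI exI[of _ 0]) simp
qed

section \<open>Structures and completeness\<close>

fun eval :: "(con \<Rightarrow> 'u) \<Rightarrow> ('u \<Rightarrow> 'u \<Rightarrow> 'u) \<Rightarrow> (var \<Rightarrow> 'u) \<Rightarrow> tm \<Rightarrow> 'u" where
  "eval cn ap e (V x) = e x"
| "eval cn ap e (C c) = cn c"
| "eval cn ap e (s \<cdot> t) = ap (eval cn ap e s) (eval cn ap e t)"

text \<open>The interpretation \<open>R\<close> of equations is a parameter, so that one definition
  serves both the raw term structure, where \<open>R\<close> is membership of the equation in a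
  Henkin set, and its quotient, where \<open>R\<close> is identity.\<close>

fun sat :: "(ty \<Rightarrow> 'u set) \<Rightarrow> (con \<Rightarrow> 'u) \<Rightarrow> ('u \<Rightarrow> 'u \<Rightarrow> 'u) \<Rightarrow> ('u \<Rightarrow> 'u \<Rightarrow> bool) \<Rightarrow>
    (var \<Rightarrow> 'u) \<Rightarrow> fm \<Rightarrow> bool" where
  "sat D cn ap R e Bot = False"
| "sat D cn ap R e (Eq s t) = R (eval cn ap e s) (eval cn ap e t)"
| "sat D cn ap R e (p \<^bold>\<longrightarrow> q) = (sat D cn ap R e p \<longrightarrow> sat D cn ap R e q)"
| "sat D cn ap R e (Forall x p) = (\<forall>a\<in>D (snd x). sat D cn ap R (e(x := a)) p)"

definition env :: "(ty \<Rightarrow> 'u set) \<Rightarrow> (var \<Rightarrow> 'u) \<Rightarrow> bool" where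
  "env D e \<longleftrightarrow> (\<forall>x. e x \<in> D (snd x))"

lemma env_upd [simp]: "env D e \<Longrightarrow> a \<in> D (snd x) \<Longrightarrow> env D (e(x := a))"
  by (simp add: env_def del: split_paired_All)

lemma eval_cong: "(\<And>x. x \<in> fv_tm t \<Longrightarrow> e x = e' x) \<Longrightarrow> eval cn ap e t = eval cn ap e' t"
  by (induction t) auto

lemma eval_closed: "fv_tm t = {} \<Longrightarrow> eval cn ap e t = eval cn ap e' t"
  by (rule eval_cong) simp

lemma eval_C_App [simp]: "eval C App \<theta> t = subst_tm \<theta> t"
  by (induction t) auto

lemma subst_tm_closed: "fv_tm t = {} \<Longrightarrow> subst_tm \<theta> t = t"
  using subst_tm_cong[of t \<theta> V] by simp

lemma fv_lam [simp]: "fv_tm (lam x t) = fv_tm t - {x}"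
  by (induction x t rule: lam.induct) auto

lemma lam_typed: "wt t \<Longrightarrow> wt (lam x t) \<and> ty_of (lam x t) = snd x \<rightarrow> ty_of t"
  by (induction x t rule: lam.induct) auto

lemma wt_lam [simp]: "wt t \<Longrightarrow> wt (lam x t)"
  and ty_of_lam [simp]: "wt t \<Longrightarrow> ty_of (lam x t) = snd x \<rightarrow> ty_of t"
  using lam_typed by blast+

lemma sub_tm_typed [simp]: "wt sub_tm" "ty_of sub_tm = N \<rightarrow> N \<rightarrow> N" "fv_tm sub_tm = {}"
  by (auto simp: sub_tm_def pred_tm_def)

lemma ty_of_zero_at [simp]: "ty_of (zero_at \<sigma>) = \<sigma>"
  by (induction \<sigma>) auto

lemma wt_zero_at [simp]: "wt (zero_at \<sigma>)"
  by (induction \<sigma>) auto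

lemma fv_zero_at [simp]: "fv_tm (zero_at \<sigma>) = {}"
  by (induction \<sigma>) auto

lemma wff_eq_aux: "wt s \<Longrightarrow> wt t \<Longrightarrow> ty_of s = \<sigma> \<Longrightarrow> ty_of t = \<sigma> \<Longrightarrow> wff (eq_aux \<sigma> k s t)"
  by (induction \<sigma> k s t rule: eq_aux.induct) auto

lemma wff_EqT: "wt s \<Longrightarrow> wt t \<Longrightarrow> ty_of s = \<sigma> \<Longrightarrow> ty_of t = \<sigma> \<Longrightarrow> wff (EqT \<sigma> s t)"
  unfolding EqT_def by (rule wff_eq_aux)

section \<open>The term structure of a Henkin set and its extensional equality\<close>

definition terms :: "ty \<Rightarrow> tm set" where
  "terms \<sigma> = {t. wt t \<and> ty_of t = \<sigma>}"

fun eqrel :: "fm set \<Rightarrow> ty \<Rightarrow> tm \<Rightarrow> tm \<Rightarrow> bool" where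
  "eqrel M N s t = (Eq s t \<in> M)"
| "eqrel M (\<sigma> \<rightarrow> \<tau>) s t = (\<forall>u\<in>terms \<sigma>. eqrel M \<tau> (s \<cdot> u) (t \<cdot> u))"
| "eqrel M (Seq \<sigma>) s t = (Eq (len \<sigma> s) (len \<sigma> t) \<in> M \<and>
     (\<forall>i\<in>terms N. Less i (len \<sigma> s) \<in> M \<longrightarrow> eqrel M \<sigma> (ent \<sigma> s i) (ent \<sigma> t i)))"

locale henkin =
  fixes Ax M :: "fm set"
  assumes henkin: "henkin_set Ax M" and EPRA: "EPRA \<subseteq> Ax"
begin

abbreviation tsat :: "(var \<Rightarrow> tm) \<Rightarrow> fm \<Rightarrow> bool" where
  "tsat \<equiv> sat terms C App (\<lambda>s t. Eq s t \<in> M)"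

lemma thm_in: "Ax \<turnstile> p \<Longrightarrow> p \<in> M"
  using henkin by (auto simp: henkin_set_def)

lemma mp: "p \<^bold>\<longrightarrow> q \<in> M \<Longrightarrow> p \<in> M \<Longrightarrow> q \<in> M"
  using henkin by (auto simp: henkin_set_def)

lemma mp_thm: "Ax \<turnstile> p \<^bold>\<longrightarrow> q \<Longrightarrow> p \<in> M \<Longrightarrow> q \<in> M"
  using mp thm_in by blast

lemma Bot_notin: "Bot \<notin> M"
  using henkin by (auto simp: henkin_set_def)

lemma maximal: "wff p \<Longrightarrow> p \<in> M \<or> Neg p \<in> M"
  using henkin by (auto simp: henkin_set_def)

lemma witness:
  assumes "wff p"
  obtains y where "snd y = snd x" "bnd (Forall x p) \<le> fst y"
    "(subst1 x (V y) p \<^bold>\<longrightarrow> Forall x p) \<in> M"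
  using henkin assms unfolding henkin_set_def by metis

lemma Imp_iff: "wff p \<Longrightarrow> wff q \<Longrightarrow> p \<^bold>\<longrightarrow> q \<in> M \<longleftrightarrow> (p \<in> M \<longrightarrow> q \<in> M)"
  using mp mp_thm[OF prv_ex_falso[of p q]] mp_thm[OF prv_K[of q p]] maximal[of p] by blast

text \<open>Variables are interpreted by terms that may contain any variables, so plain substitution
  could capture them; hence \<open>csub\<close>. The induction varies \<open>k\<close>, since an
  arbitrary instance may force new binder names.\<close>

lemma truth:
  "typed \<theta> \<Longrightarrow> wff p \<Longrightarrow> no_clash k \<theta> p \<Longrightarrow> csub k \<theta> p \<in> M \<longleftrightarrow> tsat \<theta> p"
proof (induction p arbitrary: k \<theta>)
  case Bot
  then show ?case using Bot_notin by simp
next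
  case (Eq s t)
  then show ?case by simp
next
  case (Imp p q)
  then show ?case using no_clash_Imp[OF Imp.prems(3)] by (simp add: Imp_iff)
next
  case (Forall x p)
  have w: "wff p" using Forall.prems by simp
  have ty: "typed (\<theta>(x := t))" if "t \<in> terms (snd x)" for t
    using that Forall.prems by (simp add: terms_def)
  let ?y = "(k, snd x)"
  have nc: "no_clash (Suc k) (\<theta>(x := V ?y)) p"
    by (rule no_clash_Forall[OF Forall.prems(3)])
  show ?case
  proof
    assume in_M: "csub k \<theta> (Forall x p) \<in> M"
    have "tsat (\<theta>(x := t)) p" if t: "t \<in> terms (snd x)" for t
    proof -
      \<comment> \<open>The variables of \<open>t\<close> may coincide with binder names from
        \<open>k\<close> on, so these names are first moved beyond them.\<close>
      have "finite ((\<Union>z\<in>fv p. fv_tm (\<theta> z)) \<union> fv_tm t)" by simp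
      then obtain j where j: "\<forall>v\<in>(\<Union>z\<in>fv p. fv_tm (\<theta> z)) \<union> fv_tm t. fst v < j" "k \<le> j"
        by (rule obtain_bound)
      have below: "\<forall>z\<in>fv p - {x}. \<forall>v\<in>fv_tm (\<theta> z). fst v < Suc j"
        "\<forall>z\<in>fv p - {x}. (j, snd x) \<notin> fv_tm (\<theta> z)" "\<forall>v\<in>fv_tm t. fst v < Suc j"
        using j(1) by force+
      have "no_clash j \<theta> (Forall x p)" using j(1) by (auto simp: no_clash_def)
      then have "csub j \<theta> (Forall x p) \<in> M"
        using mp_thm[OF prv_csub_csub in_M] Forall.prems by blast
      then have "Forall (j, snd x) (csub (Suc j) (\<theta>(x := V (j, snd x))) p) \<in> M" by simp
      moreover have "Ax \<turnstile> Forall (j, snd x) (csub (Suc j) (\<theta>(x := V (j, snd x))) p) \<^bold>\<longrightarrow>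
          csub (Suc j) (\<theta>(x := t)) p"
        by (rule csub_instance[OF below(1,2)]) (use below t Forall.prems in \<open>auto simp: terms_def\<close>)
      ultimately have "csub (Suc j) (\<theta>(x := t)) p \<in> M" using mp_thm by blast
      moreover have "no_clash (Suc j) (\<theta>(x := t)) p"
        using below by (auto simp: no_clash_def)
      ultimately show ?thesis using Forall.IH[OF ty[OF t] w] by blast
    qed
    then show "tsat \<theta> (Forall x p)" by simp
  next
    assume sat: "tsat \<theta> (Forall x p)"
    let ?A = "csub (Suc k) (\<theta>(x := V ?y)) p"
    have "wff ?A" using Forall.prems by simp
    then obtain y where y: "snd y = snd x" "bnd (Forall ?y ?A) \<le> fst y"
      "(subst1 ?y (V y) ?A \<^bold>\<longrightarrow> Forall ?y ?A) \<in> M"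
      using witness[of ?A ?y] by auto
    have big: "Suc k + depth p \<le> fst y"
      using y(2) depth_le_bnd_csub[of "Suc k" p "\<theta>(x := V ?y)"]
      by (simp add: max_def split: if_splits)
    have eq: "subst1 ?y (V y) ?A = csub (Suc k) (\<theta>(x := V y)) p"
      unfolding subst_csub[OF nc]
    proof (rule csub_cong)
      fix z assume "z \<in> fv p"
      then have "z \<noteq> x \<Longrightarrow> ?y \<notin> fv_tm (\<theta> z)"
        using Forall.prems(3) by (force simp: no_clash_def)
      then show "subst_tm (V(?y := V y)) ((\<theta>(x := V ?y)) z) = (\<theta>(x := V y)) z"
        using subst_tm_unused by simp
    qed
    have "no_clash (Suc k) (\<theta>(x := V y)) p"
      unfolding no_clash_def
    proof (intro ballI)
      fix z v assume "z \<in> fv p" "v \<in> fv_tm ((\<theta>(x := V y)) z)"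
      then show "fst v < Suc k \<or> Suc k + depth p \<le> fst v"
        using Forall.prems(3) big by (cases "z = x") (auto simp: no_clash_def less_Suc_eq)
    qed
    moreover have "V y \<in> terms (snd x)" using y(1) by (simp add: terms_def)
    moreover from this sat have "tsat (\<theta>(x := V y)) p" by simp
    ultimately have "csub (Suc k) (\<theta>(x := V y)) p \<in> M"
      using Forall.IH[OF ty w] by blast
    with y(3) have "Forall ?y ?A \<in> M" unfolding eq by (rule mp)
    then show "csub k \<theta> (Forall x p) \<in> M" by simp
  qed
qed

lemma tsat_Forall_list: "tsat \<theta> (Forall_list xs p) \<Longrightarrow> typed \<theta> \<Longrightarrow> tsat \<theta> p"
proof (induction xs)
  case (Cons x xs)
  have "\<theta> x \<in> terms (snd x)" using Cons.prems by (simp add: typed_def terms_def del: split_paired_All)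
  with Cons.prems(1) have "tsat (\<theta>(x := \<theta> x)) (Forall_list xs p)"
    unfolding Forall_list_def by auto
  then show ?case using Cons by simp
qed (simp add: Forall_list_def)

lemma tsat_V: "p \<in> M \<Longrightarrow> wff p \<Longrightarrow> tsat V p"
proof -
  assume p: "p \<in> M" "wff p"
  have b: "\<forall>v\<in>fv p. fst v < bnd p" using bnd_fv by blast
  then have "csub (bnd p) V p \<in> M"
    using mp_thm[OF conjunct2[OF prv_csub_V]] p by blast
  moreover have "no_clash (bnd p) V p" by (rule no_clash_below) (use b in simp)
  ultimately show ?thesis using truth[OF typed_V p(2)] by blast
qed

text \<open>Passing to the universal closure removes all interference between
  \<open>\<theta>\<close> and the binder names: on a sentence, \<open>csub\<close> does not depend
  on the substitution.\<close>

lemma tsat_thm: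
  assumes p: "Ax \<turnstile> p" and \<theta>: "typed \<theta>"
  shows "tsat \<theta> p"
proof -
  obtain xs where xs: "set xs = fv p" using finite_list[OF finite_fv] by blast
  let ?q = "Forall_list xs p"
  have q: "Ax \<turnstile> ?q" by (rule prv_Forall_list[OF p])
  have "fv (Forall_list ys p) = fv p - set ys" for ys
    by (induction ys) (auto simp: Forall_list_def)
  with xs have closed: "fv ?q = {}" by simp
  have "csub 0 V ?q \<in> M"
    using mp_thm[OF conjunct2[OF prv_csub_V] thm_in[OF q]] prv_wff[OF q] closed by simp
  moreover have "csub 0 V ?q = csub 0 \<theta> ?q" by (rule csub_cong) (simp add: closed)
  ultimately have "tsat \<theta> ?q"
    using truth[OF \<theta> prv_wff[OF q], of 0] by (simp add: no_clash_def closed)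
  then show ?thesis using \<theta> by (rule tsat_Forall_list)
qed

lemma axiom: "p \<in> EPRA \<Longrightarrow> wff p \<Longrightarrow> p \<in> M"
  using EPRA by (blast intro: thm_in ax)

lemma Eq_refl: "s \<in> terms N \<Longrightarrow> Eq s s \<in> M"
  by (rule axiom) (auto simp: terms_def intro: EPRA.intros)

lemma Eq_eucl:
  assumes "s \<in> terms N" "t \<in> terms N" "u \<in> terms N" "Eq s t \<in> M" "Eq s u \<in> M"
  shows "Eq t u \<in> M"
proof -
  have "Eq s t \<^bold>\<longrightarrow> Eq s u \<^bold>\<longrightarrow> Eq t u \<in> M"
    by (rule axiom) (use assms in \<open>auto simp: terms_def intro: EPRA.intros\<close>)
  then show ?thesis using assms(4,5) mp by blast
qed

lemma Eq_sym: "s \<in> terms N \<Longrightarrow> t \<in> terms N \<Longrightarrow> Eq s t \<in> M \<Longrightarrow> Eq t s \<in> M"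
  using Eq_eucl Eq_refl by blast

lemma Eq_trans: "s \<in> terms N \<Longrightarrow> t \<in> terms N \<Longrightarrow> u \<in> terms N \<Longrightarrow>
    Eq s t \<in> M \<Longrightarrow> Eq t u \<in> M \<Longrightarrow> Eq s u \<in> M"
  using Eq_eucl Eq_sym by blast

lemma Eq_cong:
  assumes "s \<in> terms N" "t \<in> terms N" "r \<in> terms (N \<rightarrow> N)" "Eq s t \<in> M"
  shows "Eq (r \<cdot> s) (r \<cdot> t) \<in> M"
proof -
  have "EqT N s t \<^bold>\<longrightarrow> EqT N (r \<cdot> s) (r \<cdot> t) \<in> M"
    by (rule axiom[OF EPRA.ext]) (use assms in \<open>auto simp: terms_def EqT_def\<close>)
  then show ?thesis using assms(4) mp by (simp add: EqT_def)
qed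

lemma Less_cong:
  assumes "i \<in> terms N" "s \<in> terms N" "t \<in> terms N" "Eq s t \<in> M" "Less i s \<in> M"
  shows "Less i t \<in> M"
proof -
  have "sub_tm \<cdot> suc i \<in> terms (N \<rightarrow> N)" using assms by (simp add: terms_def)
  then have "Eq (sub_tm \<cdot> suc i \<cdot> s) (sub_tm \<cdot> suc i \<cdot> t) \<in> M" using Eq_cong assms by blast
  then show ?thesis
    by (rule Eq_eucl[rotated 3]) (use assms in \<open>auto simp: terms_def\<close>)
qed

lemma eqrel_refl: "s \<in> terms \<sigma> \<Longrightarrow> eqrel M \<sigma> s s"
  by (induction \<sigma> arbitrary: s) (auto simp: terms_def intro: Eq_refl)

lemma eqrel_sym: "s \<in> terms \<sigma> \<Longrightarrow> t \<in> terms \<sigma> \<Longrightarrow> eqrel M \<sigma> s t \<Longrightarrow> eqrel M \<sigma> t s"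
proof (induction \<sigma> arbitrary: s t)
  case N
  then show ?case using Eq_sym[of s t] by simp
next
  case (Fun \<sigma> \<tau>)
  then show ?case by (simp add: terms_def)
next
  case (Seq \<sigma>)
  have l: "len \<sigma> s \<in> terms N" "len \<sigma> t \<in> terms N" using Seq.prems by (auto simp: terms_def)
  have eq: "Eq (len \<sigma> t) (len \<sigma> s) \<in> M" using Eq_sym l Seq.prems by simp
  have "eqrel M \<sigma> (ent \<sigma> t i) (ent \<sigma> s i)" if "i \<in> terms N" "Less i (len \<sigma> t) \<in> M" for i
  proof (rule Seq.IH)
    show "ent \<sigma> s i \<in> terms \<sigma>" "ent \<sigma> t i \<in> terms \<sigma>"
      using that Seq.prems by (auto simp: terms_def)
    show "eqrel M \<sigma> (ent \<sigma> s i) (ent \<sigma> t i)"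
      using Seq.prems(3) that(1) Less_cong[OF that(1) l(2,1) eq that(2)] by simp
  qed
  with eq show ?case by simp
qed

lemma eqrel_trans: "s \<in> terms \<sigma> \<Longrightarrow> t \<in> terms \<sigma> \<Longrightarrow> u \<in> terms \<sigma> \<Longrightarrow>
    eqrel M \<sigma> s t \<Longrightarrow> eqrel M \<sigma> t u \<Longrightarrow> eqrel M \<sigma> s u"
proof (induction \<sigma> arbitrary: s t u)
  case N
  then show ?case using Eq_trans[of s t u] by simp
next
  case (Fun \<sigma> \<tau>)
  have "eqrel M \<tau> (s \<cdot> v) (u \<cdot> v)" if "v \<in> terms \<sigma>" for v
    by (rule Fun.IH(2)[of _ "t \<cdot> v"]) (use that Fun.prems in \<open>auto simp: terms_def\<close>)
  then show ?case by simp
next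
  case (Seq \<sigma>)
  have l: "len \<sigma> s \<in> terms N" "len \<sigma> t \<in> terms N" "len \<sigma> u \<in> terms N"
    using Seq.prems by (auto simp: terms_def)
  have eq: "Eq (len \<sigma> s) (len \<sigma> t) \<in> M" "Eq (len \<sigma> t) (len \<sigma> u) \<in> M"
    using Seq.prems by simp_all
  have "eqrel M \<sigma> (ent \<sigma> s i) (ent \<sigma> u i)" if "i \<in> terms N" "Less i (len \<sigma> s) \<in> M" for i
  proof (rule Seq.IH[of _ "ent \<sigma> t i"])
    show "eqrel M \<sigma> (ent \<sigma> s i) (ent \<sigma> t i)" "eqrel M \<sigma> (ent \<sigma> t i) (ent \<sigma> u i)"
      using Seq.prems(4,5) that Less_cong[OF that(1) l(1,2) eq(1) that(2)] by simp_all
  qed (use that Seq.prems in \<open>auto simp: terms_def\<close>)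
  with Eq_trans[OF l eq] show ?case by simp
qed

lemma subst_tm_fresh:
  assumes "fresh_index t \<le> k"
  shows "subst_tm (\<theta>((k, \<sigma>) := u)) t = subst_tm \<theta> t"
proof (rule subst_tm_cong)
  fix v assume "v \<in> fv_tm t"
  then have "v \<noteq> (k, \<sigma>)" using fresh_index_fv_tm[of v t] assms by auto
  then show "(\<theta>((k, \<sigma>) := u)) v = \<theta> v" by simp
qed

lemma tsat_eq_aux:
  "fresh_index s \<le> k \<Longrightarrow> fresh_index t \<le> k \<Longrightarrow>
    tsat \<theta> (eq_aux \<sigma> k s t) \<longleftrightarrow> eqrel M \<sigma> (subst_tm \<theta> s) (subst_tm \<theta> t)"
proof (induction \<sigma> k s t arbitrary: \<theta> rule: eq_aux.induct)
  case (1 k s t)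
  then show ?case by simp
next
  case (2 \<sigma> \<tau> k s t)
  have "fresh_index (s \<cdot> V (k, \<sigma>)) \<le> Suc k" "fresh_index (t \<cdot> V (k, \<sigma>)) \<le> Suc k"
    using 2(2,3) by simp_all
  from 2(1)[OF this] show ?case
    using 2(2,3) by (simp add: subst_tm_fresh del: fun_upd_apply) (simp add: subst_tm_fresh)
next
  case (3 \<sigma> k s t)
  have "fresh_index (ent \<sigma> s (V (k, N))) \<le> Suc k" "fresh_index (ent \<sigma> t (V (k, N))) \<le> Suc k"
    using 3(2,3) by simp_all
  from 3(1)[OF this] show ?case
    using 3(2,3) by (simp add: subst_tm_fresh subst_tm_closed del: fun_upd_apply) (simp add: subst_tm_fresh)
qed

lemma tsat_EqT: "tsat \<theta> (EqT \<sigma> s t) \<longleftrightarrow> eqrel M \<sigma> (subst_tm \<theta> s) (subst_tm \<theta> t)"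
  unfolding EqT_def by (rule tsat_eq_aux) auto

text \<open>The extensionality axiom of the theory becomes the congruence that makes application of
  classes well defined.\<close>

lemma eqrel_cong:
  assumes "s \<in> terms \<sigma>" "t \<in> terms \<sigma>" "r \<in> terms (\<sigma> \<rightarrow> \<tau>)" "eqrel M \<sigma> s t"
  shows "eqrel M \<tau> (r \<cdot> s) (r \<cdot> t)"
proof -
  have "wff (EqT \<sigma> s t)" "wff (EqT \<tau> (r \<cdot> s) (r \<cdot> t))"
    by (rule wff_EqT; use assms in \<open>simp add: terms_def\<close>)+
  moreover have "EqT \<sigma> s t \<^bold>\<longrightarrow> EqT \<tau> (r \<cdot> s) (r \<cdot> t) \<in> Ax"
    using EPRA by (rule subsetD) (rule EPRA.ext)
  ultimately have "Ax \<turnstile> EqT \<sigma> s t \<^bold>\<longrightarrow> EqT \<tau> (r \<cdot> s) (r \<cdot> t)"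
    by (intro ax) simp_all
  from tsat_thm[OF this typed_V] assms(4) show ?thesis by (simp add: tsat_EqT)
qed

end

text \<open>In \<open>seq_ext\<close> the equation assumed of \<open>i\<close> is the value of
  \<open>Less i (len s)\<close>; its environment may be arbitrary since \<open>sub_tm\<close> is
  closed. Nothing forces the domain at \<open>N\<close> to consist of numerals.\<close>

locale model =
  fixes Ax :: "fm set" and D :: "ty \<Rightarrow> 'u set" and cn :: "con \<Rightarrow> 'u" and ap :: "'u \<Rightarrow> 'u \<Rightarrow> 'u"
  assumes EPRA: "EPRA \<subseteq> Ax"
    and cn: "cn c \<in> D (con_ty c)"
    and ap: "f \<in> D (\<sigma> \<rightarrow> \<tau>) \<Longrightarrow> a \<in> D \<sigma> \<Longrightarrow> ap f a \<in> D \<tau>"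
    and fun_ext: "f \<in> D (\<sigma> \<rightarrow> \<tau>) \<Longrightarrow> g \<in> D (\<sigma> \<rightarrow> \<tau>) \<Longrightarrow> (\<And>a. a \<in> D \<sigma> \<Longrightarrow> ap f a = ap g a) \<Longrightarrow> f = g"
    and seq_ext: "s \<in> D (Seq \<sigma>) \<Longrightarrow> t \<in> D (Seq \<sigma>) \<Longrightarrow> ap (cn (Len \<sigma>)) s = ap (cn (Len \<sigma>)) t \<Longrightarrow>
      (\<And>i. i \<in> D N \<Longrightarrow>
        ap (ap (eval cn ap (\<lambda>_. undefined) sub_tm) (ap (cn Succ) i)) (ap (cn (Len \<sigma>)) s) = cn Zero \<Longrightarrow>
        ap (ap (cn (Ent \<sigma>)) s) i = ap (ap (cn (Ent \<sigma>)) t) i) \<Longrightarrow> s = t"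
    and sat_ax: "p \<in> Ax \<Longrightarrow> wff p \<Longrightarrow> env D e \<Longrightarrow> sat D cn ap (=) e p"

text \<open>Terms that \<open>M\<close> makes hereditarily extensionally equal need not be identical; dividing by this
  congruence gives a model with genuine equality at all types.\<close>

context henkin
begin

definition cls :: "tm \<Rightarrow> tm set" where
  "cls t = {s \<in> terms (ty_of t). eqrel M (ty_of t) t s}"

definition cap :: "tm set \<Rightarrow> tm set \<Rightarrow> tm set" where
  "cap X Y = cls ((SOME s. s \<in> X) \<cdot> (SOME t. t \<in> Y))"

abbreviation cdom :: "ty \<Rightarrow> tm set set" where
  "cdom \<sigma> \<equiv> cls ` terms \<sigma>"

abbreviation ccon :: "con \<Rightarrow> tm set" where
  "ccon c \<equiv> cls (C c)"

lemma cls_eq_iff: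
  assumes "s \<in> terms \<sigma>" "t \<in> terms \<sigma>"
  shows "cls s = cls t \<longleftrightarrow> eqrel M \<sigma> s t"
proof
  have ty: "ty_of s = \<sigma>" "ty_of t = \<sigma>" using assms by (auto simp: terms_def)
  show "eqrel M \<sigma> s t" if "cls s = cls t"
    using that eqrel_refl[OF assms(2)] assms(2) unfolding cls_def ty by blast
  show "cls s = cls t" if "eqrel M \<sigma> s t"
    unfolding cls_def ty
    using that assms eqrel_trans[OF assms] eqrel_trans[OF assms(2,1)] eqrel_sym[OF assms] by blast
qed

lemma some_cls:
  assumes "t \<in> terms \<sigma>"
  shows "(SOME s. s \<in> cls t) \<in> terms \<sigma> \<and> eqrel M \<sigma> t (SOME s. s \<in> cls t)"
proof -
  have ty: "ty_of t = \<sigma>" using assms by (simp add: terms_def)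
  have "t \<in> cls t" using assms eqrel_refl unfolding cls_def ty by blast
  then have "(SOME s. s \<in> cls t) \<in> cls t" by (rule someI)
  then show ?thesis unfolding cls_def ty by blast
qed

lemma App_in_terms: "s \<in> terms (\<sigma> \<rightarrow> \<tau>) \<Longrightarrow> t \<in> terms \<sigma> \<Longrightarrow> s \<cdot> t \<in> terms \<tau>"
  by (auto simp: terms_def)

text \<open>The argument is exchanged by \<open>eqrel_cong\<close> and the function by the
  definition of \<open>eqrel\<close> at function types, so the representatives picked by
  \<open>SOME\<close> do not matter.\<close>

lemma cap_cls:
  assumes "s \<in> terms (\<sigma> \<rightarrow> \<tau>)" "t \<in> terms \<sigma>"
  shows "cap (cls s) (cls t) = cls (s \<cdot> t)"
proof -
  define s' t' where "s' = (SOME u. u \<in> cls s)" and "t' = (SOME u. u \<in> cls t)"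
  have s': "s' \<in> terms (\<sigma> \<rightarrow> \<tau>)" "eqrel M (\<sigma> \<rightarrow> \<tau>) s s'"
    using some_cls[OF assms(1)] by (simp_all add: s'_def)
  have t': "t' \<in> terms \<sigma>" "eqrel M \<sigma> t t'"
    using some_cls[OF assms(2)] by (simp_all add: t'_def)
  have 1: "eqrel M \<tau> (s \<cdot> t) (s \<cdot> t')" using eqrel_cong assms t' by blast
  have 2: "eqrel M \<tau> (s \<cdot> t') (s' \<cdot> t')" using s'(2) t'(1) by simp
  have "eqrel M \<tau> (s \<cdot> t) (s' \<cdot> t')"
    by (rule eqrel_trans[OF _ _ _ 1 2]) (use assms s'(1) t'(1) App_in_terms in blast)+
  then have "cls (s \<cdot> t) = cls (s' \<cdot> t')"
    using cls_eq_iff App_in_terms assms s'(1) t'(1) by blast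
  then show ?thesis by (simp add: cap_def s'_def t'_def)
qed

lemma typed_in_terms: "typed \<theta> \<Longrightarrow> wt t \<Longrightarrow> ty_of t = \<sigma> \<Longrightarrow> subst_tm \<theta> t \<in> terms \<sigma>"
  by (simp add: terms_def)

lemma eval_cls: "typed \<theta> \<Longrightarrow> wt t \<Longrightarrow> eval ccon cap (\<lambda>x. cls (\<theta> x)) t = cls (subst_tm \<theta> t)"
proof (induction t)
  case (App s t)
  then have "subst_tm \<theta> s \<in> terms (ty_of t \<rightarrow> ty_of (s \<cdot> t))" "subst_tm \<theta> t \<in> terms (ty_of t)"
    by (auto intro: typed_in_terms)
  from cap_cls[OF this] show ?case using App by simp
qed auto

lemma sat_cls: "typed \<theta> \<Longrightarrow> wff p \<Longrightarrow> sat cdom ccon cap (=) (\<lambda>x. cls (\<theta> x)) p \<longleftrightarrow> tsat \<theta> p"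
proof (induction p arbitrary: \<theta>)
  case (Eq s t)
  then show ?case
    using cls_eq_iff[OF typed_in_terms[of \<theta> s N] typed_in_terms[of \<theta> t N]] by (simp add: eval_cls)
next
  case (Forall x p)
  have "(\<lambda>z. cls (\<theta> z))(x := cls t) = (\<lambda>z. cls ((\<theta>(x := t)) z))" for t by (rule HOL.ext) simp
  moreover have "sat cdom ccon cap (=) (\<lambda>z. cls ((\<theta>(x := t)) z)) p \<longleftrightarrow> tsat (\<theta>(x := t)) p"
    if "t \<in> terms (snd x)" for t
  proof -
    have "typed (\<theta>(x := t))" using that Forall.prems(1) by (simp add: terms_def)
    moreover have "wff p" using Forall.prems(2) by simp
    ultimately show ?thesis by (rule Forall.IH)
  qed
  ultimately show ?case by simp
qed auto

lemma model_cls: "model Ax cdom ccon cap"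
proof
  show "EPRA \<subseteq> Ax" by (rule EPRA)
  show "ccon c \<in> cdom (con_ty c)" for c by (simp add: terms_def)
  show "cap f a \<in> cdom \<tau>" if "f \<in> cdom (\<sigma> \<rightarrow> \<tau>)" "a \<in> cdom \<sigma>" for f a \<sigma> \<tau>
    using that cap_cls App_in_terms by fastforce
next
  fix f g \<sigma> \<tau>
  assume fg: "f \<in> cdom (\<sigma> \<rightarrow> \<tau>)" "g \<in> cdom (\<sigma> \<rightarrow> \<tau>)"
    and eq: "\<And>a. a \<in> cdom \<sigma> \<Longrightarrow> cap f a = cap g a"
  obtain s t where st: "s \<in> terms (\<sigma> \<rightarrow> \<tau>)" "t \<in> terms (\<sigma> \<rightarrow> \<tau>)" "f = cls s" "g = cls t"
    using fg by blast
  have "eqrel M \<tau> (s \<cdot> u) (t \<cdot> u)" if u: "u \<in> terms \<sigma>" for u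
  proof -
    have "cls (s \<cdot> u) = cls (t \<cdot> u)"
      using eq[of "cls u"] st u by (simp add: cap_cls)
    then show ?thesis using cls_eq_iff App_in_terms st u by blast
  qed
  then show "f = g" using st cls_eq_iff by simp
next
  fix s t \<sigma>
  assume st: "s \<in> cdom (Seq \<sigma>)" "t \<in> cdom (Seq \<sigma>)"
    and l: "cap (ccon (Len \<sigma>)) s = cap (ccon (Len \<sigma>)) t"
    and e: "\<And>i. i \<in> cdom N \<Longrightarrow>
        cap (cap (eval ccon cap (\<lambda>_. undefined) sub_tm) (cap (ccon Succ) i)) (cap (ccon (Len \<sigma>)) s)
          = ccon Zero \<Longrightarrow>
        cap (cap (ccon (Ent \<sigma>)) s) i = cap (cap (ccon (Ent \<sigma>)) t) i"
  obtain s' t' where st': "s' \<in> terms (Seq \<sigma>)" "t' \<in> terms (Seq \<sigma>)" "s = cls s'" "t = cls t'"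
    using st by blast
  have c: "C (Len \<sigma>) \<in> terms (Seq \<sigma> \<rightarrow> N)" "C (Ent \<sigma>) \<in> terms (Seq \<sigma> \<rightarrow> N \<rightarrow> \<sigma>)"
    "sub_tm \<in> terms (N \<rightarrow> N \<rightarrow> N)" "C Succ \<in> terms (N \<rightarrow> N)" "zero \<in> terms N"
    by (auto simp: terms_def)
  have "eval ccon cap (\<lambda>_. undefined) sub_tm = eval ccon cap (\<lambda>x. cls (V x)) sub_tm"
    by (rule eval_closed) simp
  then have sub: "eval ccon cap (\<lambda>_. undefined) sub_tm = cls sub_tm"
    using eval_cls[OF typed_V, of sub_tm] by simp
  have l': "cap (ccon (Len \<sigma>)) s = cls (len \<sigma> s')" "cap (ccon (Len \<sigma>)) t = cls (len \<sigma> t')"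
    using cap_cls c st' by auto
  have lt: "len \<sigma> s' \<in> terms N" "len \<sigma> t' \<in> terms N" using App_in_terms c st' by blast+
  have "Eq (len \<sigma> s') (len \<sigma> t') \<in> M"
    using l cls_eq_iff[OF lt] by (simp add: l')
  moreover have "eqrel M \<sigma> (ent \<sigma> s' i) (ent \<sigma> t' i)" if i: "i \<in> terms N" "Less i (len \<sigma> s') \<in> M" for i
  proof -
    have t: "suc i \<in> terms N" "sub_tm \<cdot> suc i \<in> terms (N \<rightarrow> N)"
      "sub_tm \<cdot> suc i \<cdot> len \<sigma> s' \<in> terms N"
      "C (Ent \<sigma>) \<cdot> s' \<in> terms (N \<rightarrow> \<sigma>)" "C (Ent \<sigma>) \<cdot> t' \<in> terms (N \<rightarrow> \<sigma>)"
      "ent \<sigma> s' i \<in> terms \<sigma>" "ent \<sigma> t' i \<in> terms \<sigma>"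
      using i(1) st'(1,2) by (auto simp: terms_def)
    have "cap (cap (cls sub_tm) (cap (ccon Succ) (cls i))) (cls (len \<sigma> s')) =
        cls (sub_tm \<cdot> suc i \<cdot> len \<sigma> s')"
      using cap_cls[OF c(4) i(1)] cap_cls[OF c(3) t(1)] cap_cls[OF t(2) lt(1)] by simp
    also have "\<dots> = ccon Zero" using cls_eq_iff[OF t(3) c(5)] i(2) by simp
    finally have "cap (cap (ccon (Ent \<sigma>)) s) (cls i) = cap (cap (ccon (Ent \<sigma>)) t) (cls i)"
      using e[of "cls i"] i(1) unfolding sub l' by blast
    then have "cls (ent \<sigma> s' i) = cls (ent \<sigma> t' i)"
      unfolding st'(3,4) cap_cls[OF c(2) st'(1)] cap_cls[OF c(2) st'(2)]
        cap_cls[OF t(4) i(1)] cap_cls[OF t(5) i(1)] .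
    then show ?thesis using cls_eq_iff[OF t(6,7)] by blast
  qed
  ultimately show "s = t" using st' cls_eq_iff by simp
next
  fix p :: fm and e assume p: "p \<in> Ax" "wff p" and e: "env cdom e"
  \<comment> \<open>Every environment of the quotient is induced by a substitution of terms, chosen
    variable by variable, and under that substitution the axiom is true in the term
    structure.\<close>
  have "\<forall>x. \<exists>t. t \<in> terms (snd x) \<and> e x = cls t" using e unfolding env_def by blast
  then obtain \<theta> where \<theta>: "\<And>x. \<theta> x \<in> terms (snd x) \<and> e x = cls (\<theta> x)" by metis
  then have "typed \<theta>" by (simp add: typed_def terms_def)
  moreover have "e = (\<lambda>x. cls (\<theta> x))" using \<theta> by auto
  ultimately show "sat cdom ccon cap (=) e p" using sat_cls tsat_thm[OF ax[OF p]] p(2) by blast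
qed

end

text \<open>Models over the fixed type \<open>tm set\<close> suffice, since an unprovable formula
  has a countermodel made of classes of terms.\<close>

theorem completeness:
  assumes "EPRA \<subseteq> Ax" "wff p"
    and valid: "\<And>(D :: ty \<Rightarrow> tm set set) cn ap e. model Ax D cn ap \<Longrightarrow> env D e \<Longrightarrow> sat D cn ap (=) e p"
  shows "Ax \<turnstile> p"
proof (rule ccontr)
  assume n: "\<not> Ax \<turnstile> p"
  then have "\<not> Ax \<turnstile> Neg (Neg p)" using impE[OF prv_DN] assms(2) by blast
  then have "consis Ax (Neg p)" using assms(2) by (simp add: consis_def)
  then obtain M where M: "henkin_set Ax M" "Neg p \<in> M" using henkin_set_exists by blast
  interpret henkin Ax M using M(1) assms(1) by unfold_locales
  have "env cdom (\<lambda>x. cls (V x))" by (simp add: env_def terms_def)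
  then have "tsat V p" using valid[OF model_cls] sat_cls assms(2) typed_V by blast
  moreover have "tsat V (Neg p)" by (rule tsat_V[OF M(2)]) (use assms(2) in simp)
  ultimately show False by simp
qed

section \<open>Combinatory terms in a model\<close>

text \<open>A quantifier-free formula binds nothing, so no capture condition is needed. Both the
  induction axioms and the choice axiom are read through this lemma.\<close>

lemma sat_subst_qf:
  "qf p \<Longrightarrow> sat D cn ap R e (subst \<theta> p) = sat D cn ap R (\<lambda>x. eval cn ap e (\<theta> x)) p"
proof (induction p)
  case (Eq s t)
  have "eval cn ap e (subst_tm \<theta> u) = eval cn ap (\<lambda>x. eval cn ap e (\<theta> x)) u" for u
    by (induction u) auto
  then show ?case by simp
qed auto

lemma sat_cong_qf:
  assumes "qf p" "\<And>x. x \<in> fv p \<Longrightarrow> e x = e' x"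
  shows "sat D cn ap R e p = sat D cn ap R e' p"
  using assms
proof (induction p)
  case (Eq s t)
  then show ?case using eval_cong[of s e e'] eval_cong[of t e e'] by simp
qed auto

declare lam.simps [simp del]

context model
begin

notation ap (infixl "\<bullet>" 90)

abbreviation ev :: "(var \<Rightarrow> 'u) \<Rightarrow> tm \<Rightarrow> 'u" where "ev \<equiv> eval cn ap"
abbreviation msat :: "(var \<Rightarrow> 'u) \<Rightarrow> fm \<Rightarrow> bool" where "msat \<equiv> sat D cn ap (=)"
abbreviation Z :: 'u where "Z \<equiv> cn Zero"
abbreviation Sc :: "'u \<Rightarrow> 'u" where "Sc a \<equiv> cn Succ \<bullet> a"

lemma ev_in_on:
  "wt t \<Longrightarrow> (\<And>x. x \<in> fv_tm t \<Longrightarrow> e x \<in> D (snd x)) \<Longrightarrow> ev e t \<in> D (ty_of t)"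
proof (induction t)
  case (App s t)
  have "ev e s \<in> D (ty_of t \<rightarrow> ty_of (s \<cdot> t))" "ev e t \<in> D (ty_of t)"
    using App by auto
  then have "ap (ev e s) (ev e t) \<in> D (ty_of (s \<cdot> t))" by (rule ap)
  then show ?case by simp
qed (auto simp: cn)

text \<open>A default environment: each type is inhabited by the value of its closed zero
  term.\<close>

definition e0 :: "var \<Rightarrow> 'u" where
  "e0 x = ev (\<lambda>_. undefined) (zero_at (snd x))"

lemma env_e0 [simp]: "env D e0"
  using ev_in_on[of "zero_at _"] by (simp add: env_def e0_def)

lemma ev_in: "wt t \<Longrightarrow> env D e \<Longrightarrow> ty_of t = \<sigma> \<Longrightarrow> ev e t \<in> D \<sigma>"
  using ev_in_on by (auto simp: env_def)

definition cv :: "tm \<Rightarrow> 'u" where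
  "cv t = ev e0 t"

lemma ev_closed: "fv_tm t = {} \<Longrightarrow> ev e t = cv t"
  unfolding cv_def by (rule eval_closed)

lemma cv_in: "wt t \<Longrightarrow> ty_of t = \<sigma> \<Longrightarrow> cv t \<in> D \<sigma>"
  unfolding cv_def by (rule ev_in) simp_all

lemma ev_sub [simp]: "ev e sub_tm = cv sub_tm"
  by (rule ev_closed) simp

abbreviation sb :: "'u \<Rightarrow> 'u \<Rightarrow> 'u" where "sb a b \<equiv> cv sub_tm \<bullet> a \<bullet> b"

lemma Z_in [simp]: "Z \<in> D N"
  using cn[of Zero] by simp

lemma ev_fresh:
  assumes "fresh_index t \<le> k"
  shows "ev (e((k, \<sigma>) := u)) t = ev e t"
proof (rule eval_cong)
  fix v assume "v \<in> fv_tm t"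
  then have "v \<noteq> (k, \<sigma>)" using fresh_index_fv_tm[of v t] assms by auto
  then show "(e((k, \<sigma>) := u)) v = e v" by simp
qed

text \<open>The extensionality of the model, \<open>fun_ext\<close> and \<open>seq_ext\<close>,
  collapses the hereditary definition to identity.\<close>

lemma msat_eq_aux:
  "fresh_index s \<le> k \<Longrightarrow> fresh_index t \<le> k \<Longrightarrow> wt s \<Longrightarrow> wt t \<Longrightarrow> ty_of s = \<sigma> \<Longrightarrow> ty_of t = \<sigma> \<Longrightarrow>
    env D e \<Longrightarrow> msat e (eq_aux \<sigma> k s t) \<longleftrightarrow> ev e s = ev e t"
proof (induction \<sigma> k s t arbitrary: e rule: eq_aux.induct)
  case (1 k s t)
  then show ?case by simp
next
  case (2 \<sigma> \<tau> k s t)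
  have "ev e s \<in> D (\<sigma> \<rightarrow> \<tau>)" "ev e t \<in> D (\<sigma> \<rightarrow> \<tau>)" using 2 by (auto intro: ev_in)
  then have "\<forall>a\<in>D \<sigma>. ev e s \<bullet> a = ev e t \<bullet> a \<Longrightarrow> ev e s = ev e t"
    by (rule fun_ext) simp
  then have "(\<forall>a\<in>D \<sigma>. ev e s \<bullet> a = ev e t \<bullet> a) \<longleftrightarrow> ev e s = ev e t" by metis
  moreover have "msat (e((k, \<sigma>) := a)) (eq_aux \<tau> (Suc k) (s \<cdot> V (k, \<sigma>)) (t \<cdot> V (k, \<sigma>)))
      \<longleftrightarrow> ev e s \<bullet> a = ev e t \<bullet> a" if "a \<in> D \<sigma>" for a
    using 2 that by (subst 2(1)) (simp_all add: ev_fresh del: fun_upd_apply, simp)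
  ultimately show ?case by simp
next
  case (3 \<sigma> k s t)
  have st: "ev e s \<in> D (Seq \<sigma>)" "ev e t \<in> D (Seq \<sigma>)" using 3 by (auto intro: ev_in)
  have "msat (e((k, N) := a)) (eq_aux \<sigma> (Suc k) (ent \<sigma> s (V (k, N))) (ent \<sigma> t (V (k, N))))
      \<longleftrightarrow> cn (Ent \<sigma>) \<bullet> ev e s \<bullet> a = cn (Ent \<sigma>) \<bullet> ev e t \<bullet> a" if "a \<in> D N" for a
    using 3 that by (subst 3(1)) (simp_all add: ev_fresh del: fun_upd_apply, simp)
  then have "msat e (eq_aux (Seq \<sigma>) k s t) \<longleftrightarrow>
      cn (Len \<sigma>) \<bullet> ev e s = cn (Len \<sigma>) \<bullet> ev e t \<and>
      (\<forall>i\<in>D N. sb (Sc i) (cn (Len \<sigma>) \<bullet> ev e s) = Z \<longrightarrow>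
        cn (Ent \<sigma>) \<bullet> ev e s \<bullet> i = cn (Ent \<sigma>) \<bullet> ev e t \<bullet> i)"
    using 3(2,3) by (simp add: ev_fresh del: fun_upd_apply) (auto simp add: fun_upd_def)
  then show ?case using seq_ext[OF st] by (auto simp: ev_closed)
qed

lemma msat_EqT:
  "wt s \<Longrightarrow> wt t \<Longrightarrow> ty_of s = \<sigma> \<Longrightarrow> ty_of t = \<sigma> \<Longrightarrow> env D e \<Longrightarrow>
    msat e (EqT \<sigma> s t) \<longleftrightarrow> ev e s = ev e t"
  unfolding EqT_def by (rule msat_eq_aux) auto

lemma axiom: "p \<in> EPRA \<Longrightarrow> wff p \<Longrightarrow> env D e \<Longrightarrow> msat e p"
  using EPRA sat_ax by blast

lemma axiom_EqT:
  assumes "EqT \<sigma> s t \<in> EPRA" "wt s" "wt t" "ty_of s = \<sigma>" "ty_of t = \<sigma>" "env D e"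
  shows "ev e s = ev e t"
  using axiom[OF assms(1) wff_EqT assms(6)] msat_EqT assms by blast

lemma K_eq: "a \<in> D \<sigma> \<Longrightarrow> b \<in> D \<tau> \<Longrightarrow> cn (K \<sigma> \<tau>) \<bullet> a \<bullet> b = a"
  using axiom_EqT[OF EPRA.K_ax[of \<sigma> \<tau> "V (0, \<sigma>)" "V (1, \<tau>)"], of "e0((0, \<sigma>) := a, (1, \<tau>) := b)"]
  by simp

lemma S_eq:
  assumes "f \<in> D (\<rho> \<rightarrow> \<sigma> \<rightarrow> \<tau>)" "g \<in> D (\<rho> \<rightarrow> \<sigma>)" "a \<in> D \<rho>"
  shows "cn (S \<rho> \<sigma> \<tau>) \<bullet> f \<bullet> g \<bullet> a = f \<bullet> a \<bullet> (g \<bullet> a)"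
  using axiom_EqT[OF EPRA.S_ax[of \<tau> \<rho> \<sigma> "V (0, \<rho> \<rightarrow> \<sigma> \<rightarrow> \<tau>)" "V (1, \<rho> \<rightarrow> \<sigma>)" "V (2, \<rho>)"],
      of "e0((0, \<rho> \<rightarrow> \<sigma> \<rightarrow> \<tau>) := f, (1, \<rho> \<rightarrow> \<sigma>) := g, (2, \<rho>) := a)"] assms
  by simp

text \<open>As a rewrite rule this replaces the unfolding of abstractions into combinators, so that
  defined terms compute on their arguments. The last case split follows the shortcut by which
  \<open>lam\<close> treats an application without \<open>x\<close> as a constant.\<close>

lemma beta [simp]:
  assumes "wt t" "env D e" "a \<in> D (snd x)"
  shows "ev e (lam x t) \<bullet> a = ev (e(x := a)) t"
  using assms
proof (induction x t rule: lam.induct)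
  case (1 x y)
  have K: "cn (K \<sigma> \<tau>) \<in> D (\<sigma> \<rightarrow> \<tau> \<rightarrow> \<sigma>)" for \<sigma> \<tau> using cn[of "K \<sigma> \<tau>"] by simp
  show ?case
  proof (cases "y = x")
    case True
    have "cn (K (snd x) (snd x)) \<bullet> a \<in> D (snd x \<rightarrow> snd x)" using ap[OF K 1(3)] .
    with True show ?thesis using S_eq[OF K K 1(3)] K_eq[OF 1(3)] by (simp add: lam.simps)
  next
    case False
    have "e y \<in> D (snd y)" using 1(2) by (simp add: env_def del: split_paired_All)
    with False show ?thesis using K_eq[OF _ 1(3)] by (simp add: lam.simps)
  qed
next
  case (2 x c)
  then show ?case using K_eq[OF cn] by (simp add: lam.simps)
next
  case (3 x s t)
  have w: "wt s" "wt t" and ty: "ty_of s = ty_of t \<rightarrow> ty_of (s \<cdot> t)" using 3(3) by simp_all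
  show ?case
  proof (cases "x \<in> fv_tm (s \<cdot> t)")
    case True
    have "ev e (lam x s) \<in> D (snd x \<rightarrow> ty_of t \<rightarrow> ty_of (s \<cdot> t))" "ev e (lam x t) \<in> D (snd x \<rightarrow> ty_of t)"
      using w ty by (auto intro!: ev_in 3(4))
    from S_eq[OF this 3(5)] show ?thesis
      using True 3(1)[OF True w(1) 3(4,5)] 3(2)[OF True w(2) 3(4,5)]
      by (simp add: lam.simps del: fv_tm.simps ty_of.simps)
  next
    case False
    have "ev e (s \<cdot> t) \<in> D (ty_of (s \<cdot> t))" by (rule ev_in[OF 3(3,4)]) simp
    from K_eq[OF this 3(5)] have "ev e (lam x (s \<cdot> t)) \<bullet> a = ev e (s \<cdot> t)"
      using False by (simp add: lam.simps del: fv_tm.simps ty_of.simps)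
    also have "\<dots> = ev (e(x := a)) (s \<cdot> t)" by (rule eval_cong) (use False in auto)
    finally show ?thesis .
  qed
qed

end

section \<open>Arithmetic in a model\<close>

abbreviation NN :: ty where "NN \<equiv> N \<rightarrow> N"

definition dbl_tm :: tm where
  "dbl_tm = lam (0, N)
     (C Rec \<cdot> V (0, N) \<cdot> zero \<cdot> lam (1, N) (lam (2, N) (suc (suc (V (1, N))))))"

definition par_tm :: tm where
  "par_tm = lam (0, N)
     (C Rec \<cdot> V (0, N) \<cdot> zero \<cdot> lam (1, N) (lam (2, N) (sub_tm \<cdot> suc zero \<cdot> V (1, N))))"

definition half_tm :: tm where
  "half_tm = lam (0, N)
     (C Rec \<cdot> V (0, N) \<cdot> zero \<cdot> lam (1, N) (lam (2, N) (add_tm \<cdot> V (1, N) \<cdot> (par_tm \<cdot> V (2, N)))))"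

definition shift_tm :: tm where
  "shift_tm = lam (0, N) (lam (1, N)
     (C Rec \<cdot> V (1, N) \<cdot> V (0, N) \<cdot> lam (2, N) (lam (3, N) (half_tm \<cdot> V (2, N)))))"

definition bound_tm :: tm where
  "bound_tm = lam (0, N)
     (C Rec \<cdot> V (0, N) \<cdot> zero \<cdot> lam (1, N) (lam (2, N) (suc (dbl_tm \<cdot> V (1, N)))))"

text \<open>\<open>bit_tm k c\<close> is the binary expansion of \<open>c < 2 ^ k\<close>, most significant bit first, so that dropping
  the last bit is halving; \<open>bound_tm k\<close> is \<open>2 ^ k - 1\<close>, and \<open>word_tm b k\<close> is the number with bits
  \<open>b 0, \<dots>, b (k - 1)\<close>.\<close>

definition bit_tm :: tm where
  "bit_tm = lam (0, N) (lam (1, N) (lam (2, N)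
     (par_tm \<cdot> (shift_tm \<cdot> V (1, N) \<cdot> (sub_tm \<cdot> V (0, N) \<cdot> suc (V (2, N)))))))"

definition word_tm :: tm where
  "word_tm = lam (0, NN) (lam (1, N)
     (C Rec \<cdot> V (1, N) \<cdot> zero
        \<cdot> lam (2, N) (lam (3, N) (add_tm \<cdot> (dbl_tm \<cdot> V (2, N)) \<cdot> (V (0, NN) \<cdot> V (3, N))))))"

text \<open>The inner recursion is only a case distinction: its step keeps the earlier verdict. The
  result is 1 if the function has a zero below the bound, and 0 otherwise.\<close>

definition search_tm :: tm where
  "search_tm = lam (0, NN) (lam (1, N)
     (C Rec \<cdot> V (1, N) \<cdot> zero
        \<cdot> lam (2, N) (lam (3, N)
            (C Rec \<cdot> (V (0, NN) \<cdot> V (3, N)) \<cdot> suc zero \<cdot> lam (4, N) (lam (5, N) (V (2, N)))))))"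

text \<open>The search bound is \<open>2 ^ k\<close>, one more than the largest number with
  \<open>k\<close> bits. The value 0 reports that no binary sequence of length \<open>k\<close>
  belongs to the tree.\<close>

definition test_tm :: tm where
  "test_tm = lam (0, NN) (lam (1, N)
     (search_tm \<cdot> lam (2, N) (V (0, NN) \<cdot> (code_tm \<cdot> tab N (bit_tm \<cdot> V (1, N) \<cdot> V (2, N)) (V (1, N))))
        \<cdot> suc (bound_tm \<cdot> V (1, N))))"

text \<open>With truncated subtraction, \<open>1 - (1 - x)\<close> is the minimum of
  \<open>x\<close> and 1, so binary functions keep their values.\<close>

definition trunc_tm :: tm where
  "trunc_tm = lam (0, NN) (lam (1, N) (sub_tm \<cdot> suc zero \<cdot> (sub_tm \<cdot> suc zero \<cdot> (V (0, NN) \<cdot> V (1, N)))))"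

lemma pred_tm_typed [simp]: "wt pred_tm" "ty_of pred_tm = NN" "fv_tm pred_tm = {}"
  by (auto simp: pred_tm_def)

lemma add_tm_typed [simp]: "wt add_tm" "ty_of add_tm = N \<rightarrow> NN" "fv_tm add_tm = {}"
  by (auto simp: add_tm_def)

lemma tri_tm_typed [simp]: "wt tri_tm" "ty_of tri_tm = NN" "fv_tm tri_tm = {}"
  by (auto simp: tri_tm_def)

lemma pair_tm_typed [simp]: "wt pair_tm" "ty_of pair_tm = N \<rightarrow> NN" "fv_tm pair_tm = {}"
  by (auto simp: pair_tm_def)

lemma code_tm_typed [simp]: "wt code_tm" "ty_of code_tm = Seq N \<rightarrow> N" "fv_tm code_tm = {}"
  by (auto simp: code_tm_def)

lemma dbl_tm_typed [simp]: "wt dbl_tm" "ty_of dbl_tm = NN" "fv_tm dbl_tm = {}"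
  by (auto simp: dbl_tm_def)

lemma par_tm_typed [simp]: "wt par_tm" "ty_of par_tm = NN" "fv_tm par_tm = {}"
  by (auto simp: par_tm_def)

lemma half_tm_typed [simp]: "wt half_tm" "ty_of half_tm = NN" "fv_tm half_tm = {}"
  by (auto simp: half_tm_def)

lemma shift_tm_typed [simp]: "wt shift_tm" "ty_of shift_tm = N \<rightarrow> NN" "fv_tm shift_tm = {}"
  by (auto simp: shift_tm_def)

lemma bound_tm_typed [simp]: "wt bound_tm" "ty_of bound_tm = NN" "fv_tm bound_tm = {}"
  by (auto simp: bound_tm_def)

lemma bit_tm_typed [simp]: "wt bit_tm" "ty_of bit_tm = N \<rightarrow> N \<rightarrow> NN" "fv_tm bit_tm = {}"
  by (auto simp: bit_tm_def)

lemma word_tm_typed [simp]: "wt word_tm" "ty_of word_tm = NN \<rightarrow> NN" "fv_tm word_tm = {}"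
  by (auto simp: word_tm_def)

lemma search_tm_typed [simp]: "wt search_tm" "ty_of search_tm = NN \<rightarrow> NN" "fv_tm search_tm = {}"
  by (auto simp: search_tm_def)

lemma test_tm_typed [simp]: "wt test_tm" "ty_of test_tm = NN \<rightarrow> NN" "fv_tm test_tm = {}"
  by (auto simp: test_tm_def)

lemma trunc_tm_typed [simp]: "wt trunc_tm" "ty_of trunc_tm = NN \<rightarrow> NN" "fv_tm trunc_tm = {}"
  by (auto simp: trunc_tm_def)

context model
begin

lemma ev_upd_unused [simp]: "x \<notin> fv_tm t \<Longrightarrow> ev (e(x := a)) t = ev e t"
  by (rule eval_cong) auto

lemma ev_tm [simp]:
  "ev e pred_tm = cv pred_tm" "ev e add_tm = cv add_tm" "ev e code_tm = cv code_tm"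
  "ev e dbl_tm = cv dbl_tm" "ev e par_tm = cv par_tm" "ev e half_tm = cv half_tm"
  "ev e shift_tm = cv shift_tm" "ev e bound_tm = cv bound_tm" "ev e bit_tm = cv bit_tm"
  "ev e word_tm = cv word_tm" "ev e search_tm = cv search_tm" "ev e test_tm = cv test_tm"
  "ev e trunc_tm = cv trunc_tm"
  by (rule ev_closed, simp)+

lemma cv_tm_in [simp]:
  "cv sub_tm \<in> D (N \<rightarrow> NN)"
  "cv pred_tm \<in> D NN" "cv add_tm \<in> D (N \<rightarrow> NN)" "cv code_tm \<in> D (Seq N \<rightarrow> N)"
  "cv dbl_tm \<in> D NN" "cv par_tm \<in> D NN" "cv half_tm \<in> D NN"
  "cv shift_tm \<in> D (N \<rightarrow> NN)" "cv bound_tm \<in> D NN" "cv bit_tm \<in> D (N \<rightarrow> N \<rightarrow> NN)"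
  "cv word_tm \<in> D (NN \<rightarrow> NN)" "cv search_tm \<in> D (NN \<rightarrow> NN)" "cv test_tm \<in> D (NN \<rightarrow> NN)"
  "cv trunc_tm \<in> D (NN \<rightarrow> NN)"
  by (rule cv_in, simp, simp)+

lemma con_in [simp]:
  "cn Succ \<in> D NN" "cn Rec \<in> D (N \<rightarrow> N \<rightarrow> (N \<rightarrow> NN) \<rightarrow> N)" "cn (Len \<sigma>) \<in> D (Seq \<sigma> \<rightarrow> N)"
  "cn (Ent \<sigma>) \<in> D (Seq \<sigma> \<rightarrow> N \<rightarrow> \<sigma>)" "cn (Tab \<sigma>) \<in> D ((N \<rightarrow> \<sigma>) \<rightarrow> N \<rightarrow> Seq \<sigma>)"
  using cn[of Succ] cn[of Rec] cn[of "Len \<sigma>"] cn[of "Ent \<sigma>"] cn[of "Tab \<sigma>"] by simp_all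

lemma ap_in [simp]:
  "f \<in> D NN \<Longrightarrow> a \<in> D N \<Longrightarrow> f \<bullet> a \<in> D N"
  "g \<in> D (N \<rightarrow> NN) \<Longrightarrow> a \<in> D N \<Longrightarrow> g \<bullet> a \<in> D NN"
  "h \<in> D (N \<rightarrow> N \<rightarrow> NN) \<Longrightarrow> a \<in> D N \<Longrightarrow> h \<bullet> a \<in> D (N \<rightarrow> NN)"
  "F \<in> D (NN \<rightarrow> NN) \<Longrightarrow> f \<in> D NN \<Longrightarrow> F \<bullet> f \<in> D NN"
  "G \<in> D (NN \<rightarrow> N) \<Longrightarrow> f \<in> D NN \<Longrightarrow> G \<bullet> f \<in> D N"
  "q \<in> D (Seq N \<rightarrow> N) \<Longrightarrow> s \<in> D (Seq N) \<Longrightarrow> q \<bullet> s \<in> D N"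
  "s \<in> D (Seq N) \<Longrightarrow> cn (Ent N) \<bullet> s \<in> D NN"
  "f \<in> D NN \<Longrightarrow> a \<in> D N \<Longrightarrow> cn (Tab N) \<bullet> f \<bullet> a \<in> D (Seq N)"
  "a \<in> D N \<Longrightarrow> b \<in> D N \<Longrightarrow> g \<in> D (N \<rightarrow> NN) \<Longrightarrow> cn Rec \<bullet> a \<bullet> b \<bullet> g \<in> D N"
  by (blast intro: ap con_in)+

lemma Rec_zero: "a \<in> D N \<Longrightarrow> f \<in> D (N \<rightarrow> NN) \<Longrightarrow> cn Rec \<bullet> Z \<bullet> a \<bullet> f = a"
  using axiom[OF EPRA.Rec_zero[of "V (0, N)" "V (1, N \<rightarrow> NN)"], of "e0((0, N) := a, (1, N \<rightarrow> NN) := f)"]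
  by simp

lemma Rec_suc: "n \<in> D N \<Longrightarrow> a \<in> D N \<Longrightarrow> f \<in> D (N \<rightarrow> NN) \<Longrightarrow>
    cn Rec \<bullet> Sc n \<bullet> a \<bullet> f = f \<bullet> (cn Rec \<bullet> n \<bullet> a \<bullet> f) \<bullet> n"
  using axiom[OF EPRA.Rec_suc[of "V (2, N)" "V (0, N)" "V (1, N \<rightarrow> NN)"],
      of "e0((0, N) := a, (1, N \<rightarrow> NN) := f, (2, N) := n)"]
  by simp

lemma lam_in [simp]: "wt t \<Longrightarrow> env D e \<Longrightarrow> snd x \<rightarrow> ty_of t = \<sigma> \<Longrightarrow> ev e (lam x t) \<in> D \<sigma>"
  by (rule ev_in) auto

lemma Rec_lam_zero [simp]:
  assumes "wt b" "ty_of b = N" "env D e" "a \<in> D N"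
  shows "cn Rec \<bullet> Z \<bullet> a \<bullet> ev e (lam (i, N) (lam (j, N) b)) = a"
  by (rule Rec_zero) (use assms in simp_all)

lemma Rec_lam_suc [simp]:
  assumes "wt b" "ty_of b = N" "env D e" "a \<in> D N" "n \<in> D N"
  shows "cn Rec \<bullet> Sc n \<bullet> a \<bullet> ev e (lam (i, N) (lam (j, N) b)) =
    ev (e((i, N) := cn Rec \<bullet> n \<bullet> a \<bullet> ev e (lam (i, N) (lam (j, N) b)), (j, N) := n)) b"
proof -
  have "ev e (lam (i, N) (lam (j, N) b)) \<in> D (N \<rightarrow> NN)" using assms by simp
  then show ?thesis using assms by (simp add: Rec_suc)
qed

lemma Sc_neq_Z [simp]: "a \<in> D N \<Longrightarrow> Sc a \<noteq> Z"
  using axiom[OF EPRA.suc_nonzero[of "V (0, N)"], of "e0((0, N) := a)"] by simp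

lemma Z_neq_Sc [simp]: "a \<in> D N \<Longrightarrow> Z \<noteq> Sc a"
  using Sc_neq_Z by metis

lemma Sc_inj [simp]: "a \<in> D N \<Longrightarrow> b \<in> D N \<Longrightarrow> Sc a = Sc b \<longleftrightarrow> a = b"
  using axiom[OF EPRA.suc_inj[of "V (0, N)" "V (1, N)"], of "e0((0, N) := a, (1, N) := b)"] by auto

text \<open>The axiom covers only predicates defined by a quantifier-free formula, here
  \<open>p\<close> with its parameters stored in \<open>e\<close>. Each application therefore names
  a formula that defines its predicate.\<close>

lemma nat_induct:
  assumes "n \<in> D N" "qf p" "wff p" "env D e"
    and P: "\<And>a. a \<in> D N \<Longrightarrow> P a \<longleftrightarrow> msat (e((0, N) := a)) p"
    and Z: "P Z" and Sc: "\<And>a. a \<in> D N \<Longrightarrow> P a \<Longrightarrow> P (Sc a)"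
  shows "P n"
proof -
  let ?x = "(0, N)"
  have s: "msat (e(?x := a)) (subst1 ?x t p) \<longleftrightarrow> msat (e(?x := ev (e(?x := a)) t)) p" for a t
    unfolding sat_subst_qf[OF assms(2)] by (rule sat_cong_qf[OF assms(2)]) simp
  have s0: "msat e (subst1 ?x zero p) \<longleftrightarrow> msat (e(?x := Z)) p"
    unfolding sat_subst_qf[OF assms(2)] by (rule sat_cong_qf[OF assms(2)]) simp
  have "msat e (subst1 ?x zero p \<^bold>\<longrightarrow> Forall ?x (p \<^bold>\<longrightarrow> subst1 ?x (suc (V ?x)) p) \<^bold>\<longrightarrow> Forall ?x p)"
    by (rule axiom[OF EPRA.qf_ind]) (use assms in simp_all)
  then have "msat (e(?x := Z)) p \<longrightarrow> (\<forall>a\<in>D N. msat (e(?x := a)) p \<longrightarrow> msat (e(?x := Sc a)) p) \<longrightarrow>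
      (\<forall>a\<in>D N. msat (e(?x := a)) p)"
    using s0 s[of _ "suc (V ?x)"] by simp
  then show ?thesis using P Z Sc assms(1) by simp
qed

section \<open>Recursion equations of the arithmetic terms\<close>

lemma pred_Z [simp]: "cv pred_tm \<bullet> Z = Z"
  unfolding cv_def[of pred_tm] by (simp add: pred_tm_def)

lemma pred_Sc [simp]: "a \<in> D N \<Longrightarrow> cv pred_tm \<bullet> Sc a = a"
  unfolding cv_def[of pred_tm] by (simp add: pred_tm_def)

lemma sub_Z [simp]: "a \<in> D N \<Longrightarrow> sb a Z = a"
  unfolding cv_def[of sub_tm] by (simp add: sub_tm_def)

lemma sub_Sc: "a \<in> D N \<Longrightarrow> b \<in> D N \<Longrightarrow> sb a (Sc b) = cv pred_tm \<bullet> sb a b"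
  unfolding cv_def[of sub_tm] by (simp add: sub_tm_def)

lemma nat_cases:
  assumes "n \<in> D N"
  obtains "n = Z" | m where "m \<in> D N" "n = Sc m"
proof -
  have "n \<noteq> Z \<longrightarrow> n = Sc (cv pred_tm \<bullet> n)"
    by (rule nat_induct[OF assms, where e = e0 and
          p = "Neg (Eq (V (0, N)) zero) \<^bold>\<longrightarrow> Eq (V (0, N)) (suc (pred_tm \<cdot> V (0, N)))"]) simp_all
  then show thesis using that assms by (metis ap_in(1) cv_tm_in(2))
qed

lemma add_Z [simp]: "a \<in> D N \<Longrightarrow> cv add_tm \<bullet> a \<bullet> Z = a"
  unfolding cv_def[of add_tm] by (simp add: add_tm_def)

lemma add_Sc [simp]: "a \<in> D N \<Longrightarrow> b \<in> D N \<Longrightarrow> cv add_tm \<bullet> a \<bullet> Sc b = Sc (cv add_tm \<bullet> a \<bullet> b)"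
  unfolding cv_def[of add_tm] by (simp add: add_tm_def)

lemma dbl_Z [simp]: "cv dbl_tm \<bullet> Z = Z"
  unfolding cv_def[of dbl_tm] by (simp add: dbl_tm_def)

lemma dbl_Sc [simp]: "a \<in> D N \<Longrightarrow> cv dbl_tm \<bullet> Sc a = Sc (Sc (cv dbl_tm \<bullet> a))"
  unfolding cv_def[of dbl_tm] by (simp add: dbl_tm_def)

lemma par_Z [simp]: "cv par_tm \<bullet> Z = Z"
  unfolding cv_def[of par_tm] by (simp add: par_tm_def)

lemma par_Sc [simp]: "a \<in> D N \<Longrightarrow> cv par_tm \<bullet> Sc a = sb (Sc Z) (cv par_tm \<bullet> a)"
  unfolding cv_def[of par_tm] by (simp add: par_tm_def)

lemma half_Z [simp]: "cv half_tm \<bullet> Z = Z"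
  unfolding cv_def[of half_tm] by (simp add: half_tm_def)

lemma half_Sc [simp]:
  "a \<in> D N \<Longrightarrow> cv half_tm \<bullet> Sc a = cv add_tm \<bullet> (cv half_tm \<bullet> a) \<bullet> (cv par_tm \<bullet> a)"
  unfolding cv_def[of half_tm] by (simp add: half_tm_def)

lemma shift_Z [simp]: "a \<in> D N \<Longrightarrow> cv shift_tm \<bullet> a \<bullet> Z = a"
  unfolding cv_def[of shift_tm] by (simp add: shift_tm_def)

lemma shift_Sc [simp]:
  "a \<in> D N \<Longrightarrow> b \<in> D N \<Longrightarrow> cv shift_tm \<bullet> a \<bullet> Sc b = cv half_tm \<bullet> (cv shift_tm \<bullet> a \<bullet> b)"
  unfolding cv_def[of shift_tm] by (simp add: shift_tm_def)

lemma bound_Z [simp]: "cv bound_tm \<bullet> Z = Z"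
  unfolding cv_def[of bound_tm] by (simp add: bound_tm_def)

lemma bound_Sc [simp]: "a \<in> D N \<Longrightarrow> cv bound_tm \<bullet> Sc a = Sc (cv dbl_tm \<bullet> (cv bound_tm \<bullet> a))"
  unfolding cv_def[of bound_tm] by (simp add: bound_tm_def)

lemma bit_eq: "k \<in> D N \<Longrightarrow> c \<in> D N \<Longrightarrow> i \<in> D N \<Longrightarrow>
    cv bit_tm \<bullet> k \<bullet> c \<bullet> i = cv par_tm \<bullet> (cv shift_tm \<bullet> c \<bullet> sb k (Sc i))"
  unfolding cv_def[of bit_tm] by (simp add: bit_tm_def)

lemma word_Z [simp]: "b \<in> D NN \<Longrightarrow> cv word_tm \<bullet> b \<bullet> Z = Z"
  unfolding cv_def[of word_tm] by (simp add: word_tm_def)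

lemma word_Sc [simp]: "b \<in> D NN \<Longrightarrow> k \<in> D N \<Longrightarrow>
    cv word_tm \<bullet> b \<bullet> Sc k = cv add_tm \<bullet> (cv dbl_tm \<bullet> (cv word_tm \<bullet> b \<bullet> k)) \<bullet> (b \<bullet> k)"
  unfolding cv_def[of word_tm] by (simp add: word_tm_def)

lemma search_Z [simp]: "f \<in> D NN \<Longrightarrow> cv search_tm \<bullet> f \<bullet> Z = Z"
  unfolding cv_def[of search_tm] by (simp add: search_tm_def)

lemma search_Sc:
  assumes "f \<in> D NN" "n \<in> D N"
  shows "cv search_tm \<bullet> f \<bullet> Sc n = (if f \<bullet> n = Z then Sc Z else cv search_tm \<bullet> f \<bullet> n)"
proof (rule nat_cases[of "f \<bullet> n"])
  show "f \<bullet> n \<in> D N" using assms by simp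
  show ?thesis if "f \<bullet> n = Z"
    using that assms unfolding cv_def[of search_tm] by (simp add: search_tm_def)
  show ?thesis if "m \<in> D N" "f \<bullet> n = Sc m" for m
    using that assms unfolding cv_def[of search_tm] by (simp add: search_tm_def)
qed

lemma trunc_eq: "f \<in> D NN \<Longrightarrow> n \<in> D N \<Longrightarrow>
    cv trunc_tm \<bullet> f \<bullet> n = sb (Sc Z) (sb (Sc Z) (f \<bullet> n))"
  unfolding cv_def[of trunc_tm] by (simp add: trunc_tm_def)

lemma test_eq:
  assumes "T \<in> D NN" "k \<in> D N"
  obtains f where "f \<in> D NN" "cv test_tm \<bullet> T \<bullet> k = cv search_tm \<bullet> f \<bullet> Sc (cv bound_tm \<bullet> k)"
    "\<And>c. c \<in> D N \<Longrightarrow> f \<bullet> c = T \<bullet> (cv code_tm \<bullet> (cn (Tab N) \<bullet> (cv bit_tm \<bullet> k \<bullet> c) \<bullet> k))"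
proof
  let ?b = "lam (2, N) (V (0, NN) \<cdot> (code_tm \<cdot> tab N (bit_tm \<cdot> V (1, N) \<cdot> V (2, N)) (V (1, N))))"
  let ?f = "ev (e0((0, NN) := T, (1, N) := k)) ?b"
  show "?f \<in> D NN" using assms by simp
  show "cv test_tm \<bullet> T \<bullet> k = cv search_tm \<bullet> ?f \<bullet> Sc (cv bound_tm \<bullet> k)"
    unfolding cv_def[of test_tm] using assms by (simp add: test_tm_def)
  show "?f \<bullet> c = T \<bullet> (cv code_tm \<bullet> (cn (Tab N) \<bullet> (cv bit_tm \<bullet> k \<bullet> c) \<bullet> k))" if "c \<in> D N" for c
    using assms that by simp
qed

section \<open>Order, addition and doubling by quantifier-free induction\<close>

lemma sub_Z_left [simp]:
  assumes "b \<in> D N" shows "sb Z b = Z"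
  by (rule nat_induct[OF assms, where e = e0 and p = "Eq (sub_tm \<cdot> zero \<cdot> V (0, N)) zero"])
    (simp_all add: sub_Sc)

lemma sub_Sc_Sc [simp]:
  assumes "a \<in> D N" "b \<in> D N" shows "sb (Sc a) (Sc b) = sb a b"
  by (rule nat_induct[OF assms(2), where e = "e0((1, N) := a)" and
        p = "Eq (sub_tm \<cdot> suc (V (1, N)) \<cdot> suc (V (0, N))) (sub_tm \<cdot> V (1, N) \<cdot> V (0, N))"])
    (use assms in \<open>simp_all add: sub_Sc\<close>)

lemma sub_self [simp]:
  assumes "a \<in> D N" shows "sb a a = Z"
  by (rule nat_induct[OF assms, where e = e0 and p = "Eq (sub_tm \<cdot> V (0, N) \<cdot> V (0, N)) zero"])
    simp_all

text \<open>Double induction follows from simple induction on \<open>j\<close>, applied to \<open>\<not> P (a - j) (b - j)\<close>.\<close>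

lemma double_induct:
  assumes ab: "a \<in> D N" "b \<in> D N" and p: "qf p" "wff p" "fv p \<subseteq> {(0, N), (1, N)}"
    and P: "\<And>a b. a \<in> D N \<Longrightarrow> b \<in> D N \<Longrightarrow> P a b \<longleftrightarrow> msat (e0((0, N) := a, (1, N) := b)) p"
    and "\<And>b. b \<in> D N \<Longrightarrow> P Z b" "\<And>a. a \<in> D N \<Longrightarrow> P a Z"
    and step: "\<And>a b. a \<in> D N \<Longrightarrow> b \<in> D N \<Longrightarrow> P a b \<Longrightarrow> P (Sc a) (Sc b)"
  shows "P a b"
proof (rule ccontr)
  assume neg: "\<not> P a b"
  let ?\<theta> = "V((0, N) := sub_tm \<cdot> V (2, N) \<cdot> V (0, N), (1, N) := sub_tm \<cdot> V (3, N) \<cdot> V (0, N))"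
  let ?e = "e0((2, N) := a, (3, N) := b)"
  have "\<not> P (sb a a) (sb b a)"
  proof (rule nat_induct[OF ab(1), where e = ?e and p = "subst ?\<theta> (Neg p)" and
        P = "\<lambda>j. \<not> P (sb a j) (sb b j)"])
    show "qf (subst ?\<theta> (Neg p))"
      using p(1) by (induction p) auto
    show "wff (subst ?\<theta> (Neg p))" using p(2) by simp
    show "env D ?e" using ab by simp
    show "\<not> P (sb a j) (sb b j) \<longleftrightarrow> msat (?e((0, N) := j)) (subst ?\<theta> (Neg p))" if j: "j \<in> D N" for j
    proof -
      have "msat (?e((0, N) := j)) (subst ?\<theta> p) \<longleftrightarrow>
          msat (e0((0, N) := sb a j, (1, N) := sb b j)) p"
        unfolding sat_subst_qf[OF p(1)] by (rule sat_cong_qf[OF p(1)]) (use p(3) in auto)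
      then show ?thesis using P[of "sb a j" "sb b j"] ab j by simp
    qed
    show "\<not> P (sb a Z) (sb b Z)" using neg ab by simp
    fix j assume j: "j \<in> D N" and n: "\<not> P (sb a j) (sb b j)"
    have in_N: "sb a j \<in> D N" "sb b j \<in> D N" using ab j by simp_all
    then obtain u v where "u \<in> D N" "sb a j = Sc u" "v \<in> D N" "sb b j = Sc v"
      using n assms(7,8) by (metis nat_cases)
    then show "\<not> P (sb a (Sc j)) (sb b (Sc j))" using n ab j step by (auto simp: sub_Sc)
  qed
  then show False using ab assms(7) by simp
qed

lemma sub_one_cases:
  assumes "a \<in> D N" shows "sb a (Sc Z) = Z \<longleftrightarrow> a = Z \<or> a = Sc Z"
  using assms by (rule nat_cases) simp_all

lemma sub_le_one:
  assumes "a \<in> D N" shows "sb (sb (Sc Z) a) (Sc Z) = Z"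
  using assms by (rule nat_cases) simp_all

lemma trunc_binary: "f \<in> D NN \<Longrightarrow> n \<in> D N \<Longrightarrow> sb (cv trunc_tm \<bullet> f \<bullet> n) (Sc Z) = Z"
  by (simp add: trunc_eq sub_le_one)

lemma trunc_id: "f \<in> D NN \<Longrightarrow> n \<in> D N \<Longrightarrow> sb (f \<bullet> n) (Sc Z) = Z \<Longrightarrow> cv trunc_tm \<bullet> f \<bullet> n = f \<bullet> n"
  by (auto simp: trunc_eq sub_one_cases)

lemma le_Suc: "a \<in> D N \<Longrightarrow> b \<in> D N \<Longrightarrow> sb a b = Z \<Longrightarrow> sb a (Sc b) = Z"
  by (simp add: sub_Sc)

lemma le_Suc_cases:
  assumes "c \<in> D N" "n \<in> D N" "sb c n = Z" "sb (Sc c) n \<noteq> Z"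
  shows "c = n"
proof -
  have "sb c n = Z \<longrightarrow> sb (Sc c) n \<noteq> Z \<longrightarrow> c = n"
  proof (rule double_induct[OF assms(1,2), where P = "\<lambda>c n. sb c n = Z \<longrightarrow> sb (Sc c) n \<noteq> Z \<longrightarrow> c = n" and
        p = "Eq (sub_tm \<cdot> V (0, N) \<cdot> V (1, N)) zero \<^bold>\<longrightarrow>
          Neg (Eq (sub_tm \<cdot> suc (V (0, N)) \<cdot> V (1, N)) zero) \<^bold>\<longrightarrow> Eq (V (0, N)) (V (1, N))"])
    fix b assume "b \<in> D N"
    then show "sb Z b = Z \<longrightarrow> sb (Sc Z) b \<noteq> Z \<longrightarrow> Z = b" by (rule nat_cases) simp_all
  qed (auto simp: insert_commute)
  with assms show ?thesis by blast
qed

lemma add_Z_left [simp]: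
  assumes "b \<in> D N" shows "cv add_tm \<bullet> Z \<bullet> b = b"
  by (rule nat_induct[OF assms, where e = e0 and p = "Eq (add_tm \<cdot> zero \<cdot> V (0, N)) (V (0, N))"]) simp_all

lemma add_Sc_left [simp]:
  assumes "a \<in> D N" "b \<in> D N" shows "cv add_tm \<bullet> Sc a \<bullet> b = Sc (cv add_tm \<bullet> a \<bullet> b)"
  by (rule nat_induct[OF assms(2), where e = "e0((1, N) := a)" and
        p = "Eq (add_tm \<cdot> suc (V (1, N)) \<cdot> V (0, N)) (suc (add_tm \<cdot> V (1, N) \<cdot> V (0, N)))"])
    (use assms in simp_all)

lemma add_sub_cancel:
  assumes "a \<in> D N" "b \<in> D N" shows "sb (cv add_tm \<bullet> a \<bullet> b) a = b"
  by (rule nat_induct[OF assms(1), where e = "e0((1, N) := b)" and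
        p = "Eq (sub_tm \<cdot> (add_tm \<cdot> V (0, N) \<cdot> V (1, N)) \<cdot> V (0, N)) (V (1, N))"])
    (use assms in simp_all)

lemma sub_add_cancel:
  assumes "m \<in> D N" "k \<in> D N" "sb m k = Z" shows "cv add_tm \<bullet> sb k m \<bullet> m = k"
proof -
  have "sb m k = Z \<longrightarrow> cv add_tm \<bullet> sb k m \<bullet> m = k"
    by (rule double_induct[OF assms(1,2), where P = "\<lambda>m k. sb m k = Z \<longrightarrow> cv add_tm \<bullet> sb k m \<bullet> m = k" and
          p = "Eq (sub_tm \<cdot> V (0, N) \<cdot> V (1, N)) zero \<^bold>\<longrightarrow>
            Eq (add_tm \<cdot> (sub_tm \<cdot> V (1, N) \<cdot> V (0, N)) \<cdot> V (0, N)) (V (1, N))"])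
      (auto simp: insert_commute)
  with assms show ?thesis by blast
qed

lemma sub_sub_cancel:
  assumes "m \<in> D N" "k \<in> D N" "sb m k = Z" shows "sb k (sb k m) = m"
  using add_sub_cancel[of "sb k m" m] sub_add_cancel[OF assms] assms by simp

lemma dbl_mono:
  assumes "a \<in> D N" "b \<in> D N" "sb a b = Z" shows "sb (cv dbl_tm \<bullet> a) (cv dbl_tm \<bullet> b) = Z"
proof -
  have "sb a b = Z \<longrightarrow> sb (cv dbl_tm \<bullet> a) (cv dbl_tm \<bullet> b) = Z"
    by (rule double_induct[OF assms(1,2), where
          P = "\<lambda>a b. sb a b = Z \<longrightarrow> sb (cv dbl_tm \<bullet> a) (cv dbl_tm \<bullet> b) = Z" and
          p = "Eq (sub_tm \<cdot> V (0, N) \<cdot> V (1, N)) zero \<^bold>\<longrightarrow>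
            Eq (sub_tm \<cdot> (dbl_tm \<cdot> V (0, N)) \<cdot> (dbl_tm \<cdot> V (1, N))) zero"])
      (auto simp: insert_commute)
  with assms show ?thesis by blast
qed

section \<open>Binary expansions\<close>

lemma par_dbl [simp]:
  assumes "a \<in> D N" shows "cv par_tm \<bullet> (cv dbl_tm \<bullet> a) = Z"
  by (rule nat_induct[OF assms, where e = e0 and p = "Eq (par_tm \<cdot> (dbl_tm \<cdot> V (0, N))) zero"]) simp_all

lemma half_dbl [simp]:
  assumes "a \<in> D N" shows "cv half_tm \<bullet> (cv dbl_tm \<bullet> a) = a"
  by (rule nat_induct[OF assms, where e = e0 and p = "Eq (half_tm \<cdot> (dbl_tm \<cdot> V (0, N))) (V (0, N))"])
    simp_all

lemma par_le_one:
  assumes "a \<in> D N" shows "sb (cv par_tm \<bullet> a) (Sc Z) = Z"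
  using assms by (rule nat_cases) (simp_all add: sub_le_one)

definition binary :: "'u \<Rightarrow> bool" where
  "binary b \<longleftrightarrow> (\<forall>n\<in>D N. sb (b \<bullet> n) (Sc Z) = Z)"

lemma binary_cases: "b \<in> D NN \<Longrightarrow> binary b \<Longrightarrow> n \<in> D N \<Longrightarrow> b \<bullet> n = Z \<or> b \<bullet> n = Sc Z"
  using sub_one_cases[of "b \<bullet> n"] by (simp add: binary_def)

context
  fixes b assumes b: "b \<in> D NN" "binary b"
begin

text \<open>With last bit 0 the word is a double. With last bit 1 it is one more, and halving then
  adds the parity of the double, which is 0.\<close>

lemma word_half: "n \<in> D N \<Longrightarrow> cv half_tm \<bullet> (cv word_tm \<bullet> b \<bullet> Sc n) = cv word_tm \<bullet> b \<bullet> n"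
  using binary_cases[OF b] b by fastforce

lemma word_par: "n \<in> D N \<Longrightarrow> cv par_tm \<bullet> (cv word_tm \<bullet> b \<bullet> Sc n) = b \<bullet> n"
  using binary_cases[OF b] b by fastforce

text \<open>Appending a bit sends \<open>w\<close> to at most \<open>2 w + 1\<close>, and this is
  exactly how the bound grows.\<close>

lemma word_bound:
  assumes "n \<in> D N" shows "sb (cv word_tm \<bullet> b \<bullet> n) (cv bound_tm \<bullet> n) = Z"
proof (rule nat_induct[OF assms, where e = "e0((1, NN) := b)" and
      p = "Eq (sub_tm \<cdot> (word_tm \<cdot> V (1, NN) \<cdot> V (0, N)) \<cdot> (bound_tm \<cdot> V (0, N))) zero"])
  fix a assume a: "a \<in> D N" "sb (cv word_tm \<bullet> b \<bullet> a) (cv bound_tm \<bullet> a) = Z"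
  have "sb (cv dbl_tm \<bullet> (cv word_tm \<bullet> b \<bullet> a)) (cv dbl_tm \<bullet> (cv bound_tm \<bullet> a)) = Z"
    by (rule dbl_mono) (use a b in simp_all)
  then show "sb (cv word_tm \<bullet> b \<bullet> Sc a) (cv bound_tm \<bullet> Sc a) = Z"
    using binary_cases[OF b a(1)] a b by (auto simp: le_Suc)
qed (use b in simp_all)

text \<open>Each halving drops the last bit. Truncated subtraction keeps the equation true for
  \<open>j\<close> beyond \<open>k\<close>, where both sides are 0.\<close>

lemma word_shift:
  assumes "k \<in> D N" "j \<in> D N"
  shows "cv shift_tm \<bullet> (cv word_tm \<bullet> b \<bullet> k) \<bullet> j = cv word_tm \<bullet> b \<bullet> sb k j"
proof (rule nat_induct[OF assms(2), where e = "e0((1, NN) := b, (2, N) := k)" and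
      p = "Eq (shift_tm \<cdot> (word_tm \<cdot> V (1, NN) \<cdot> V (2, N)) \<cdot> V (0, N))
        (word_tm \<cdot> V (1, NN) \<cdot> (sub_tm \<cdot> V (2, N) \<cdot> V (0, N)))"])
  fix a assume a: "a \<in> D N"
    "cv shift_tm \<bullet> (cv word_tm \<bullet> b \<bullet> k) \<bullet> a = cv word_tm \<bullet> b \<bullet> sb k a"
  have "sb k a \<in> D N" using a assms by simp
  then have "cv half_tm \<bullet> (cv word_tm \<bullet> b \<bullet> sb k a) = cv word_tm \<bullet> b \<bullet> (cv pred_tm \<bullet> sb k a)"
    by (rule nat_cases) (use b word_half in simp_all)
  then show "cv shift_tm \<bullet> (cv word_tm \<bullet> b \<bullet> k) \<bullet> Sc a = cv word_tm \<bullet> b \<bullet> sb k (Sc a)"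
    using a b assms by (simp add: sub_Sc)
qed (use b assms in simp_all)

text \<open>Shifting by \<open>k - (i + 1)\<close> leaves the first \<open>i + 1\<close> bits, and
  the parity of that number is its last bit \<open>b i\<close>. The rule \<open>word_Sc\<close> is
  withheld so that \<open>word_par\<close> can match.\<close>

lemma bit_word:
  assumes "k \<in> D N" "i \<in> D N" "sb (Sc i) k = Z"
  shows "cv bit_tm \<bullet> k \<bullet> (cv word_tm \<bullet> b \<bullet> k) \<bullet> i = b \<bullet> i"
  using assms b sub_sub_cancel[of "Sc i" k] word_par[of i] by (simp add: bit_eq word_shift del: word_Sc)

end

end

section \<open>Bounded search through the binary sequences of length \<open>k\<close>\<close>

context model
begin

abbreviation code :: "'u \<Rightarrow> 'u" where "code s \<equiv> cv code_tm \<bullet> s"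
abbreviation tabN :: "'u \<Rightarrow> 'u \<Rightarrow> 'u" where "tabN f n \<equiv> cn (Tab N) \<bullet> f \<bullet> n"
abbreviation lenN :: "'u \<Rightarrow> 'u" where "lenN s \<equiv> cn (Len N) \<bullet> s"
abbreviation entN :: "'u \<Rightarrow> 'u \<Rightarrow> 'u" where "entN s i \<equiv> cn (Ent N) \<bullet> s \<bullet> i"

text \<open>It is enough to treat functions without any zero: every number, even one beyond the
  search bound, has parities for bits and so describes a binary sequence.\<close>

lemma search_none:
  assumes "n \<in> D N" "f \<in> D NN" "\<And>c. c \<in> D N \<Longrightarrow> f \<bullet> c \<noteq> Z"
  shows "cv search_tm \<bullet> f \<bullet> n = Z"
  by (rule nat_induct[OF assms(1), where e = "e0((1, NN) := f)" and
        p = "Eq (search_tm \<cdot> V (1, NN) \<cdot> V (0, N)) zero"])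
    (use assms in \<open>simp_all add: search_Sc\<close>)

text \<open>The argument \<open>c\<close> stays a parameter, which keeps the induction formula free
  of bounded quantifiers. In the step, \<open>c\<close> is either below the old bound or equal to
  it.\<close>

lemma search_bounded:
  assumes "n \<in> D N" "f \<in> D NN" "c \<in> D N" "cv search_tm \<bullet> f \<bullet> n = Z" "sb (Sc c) n = Z"
  shows "f \<bullet> c \<noteq> Z"
proof -
  have "cv search_tm \<bullet> f \<bullet> n = Z \<longrightarrow> sb (Sc c) n = Z \<longrightarrow> f \<bullet> c \<noteq> Z"
  proof (rule nat_induct[OF assms(1), where e = "e0((1, NN) := f, (2, N) := c)" and
        p = "Eq (search_tm \<cdot> V (1, NN) \<cdot> V (0, N)) zero \<^bold>\<longrightarrow>
          Eq (sub_tm \<cdot> suc (V (2, N)) \<cdot> V (0, N)) zero \<^bold>\<longrightarrow> Neg (Eq (V (1, NN) \<cdot> V (2, N)) zero)"])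
    fix a assume a: "a \<in> D N" "cv search_tm \<bullet> f \<bullet> a = Z \<longrightarrow> sb (Sc c) a = Z \<longrightarrow> f \<bullet> c \<noteq> Z"
    show "cv search_tm \<bullet> f \<bullet> Sc a = Z \<longrightarrow> sb (Sc c) (Sc a) = Z \<longrightarrow> f \<bullet> c \<noteq> Z"
      using a assms(2,3) le_Suc_cases[of c a] by (auto simp: search_Sc)
  qed (use assms in simp_all)
  with assms show ?thesis by blast
qed

section \<open>Finite sequences as tables\<close>

lemma len_tab: "f \<in> D NN \<Longrightarrow> n \<in> D N \<Longrightarrow> lenN (tabN f n) = n"
  using axiom[OF EPRA.Len_Tab[of N "V (0, NN)" "V (1, N)"], of "e0((0, NN) := f, (1, N) := n)"] by simp

lemma ent_tab: "f \<in> D NN \<Longrightarrow> n \<in> D N \<Longrightarrow> i \<in> D N \<Longrightarrow> sb (Sc i) n = Z \<Longrightarrow> entN (tabN f n) i = f \<bullet> i"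
  using axiom[OF EPRA.Ent_Tab[of "V (2, N)" "V (1, N)" N "V (0, NN)"],
      of "e0((0, NN) := f, (1, N) := n, (2, N) := i)"]
  by (simp add: EqT_def)

lemma tab_cong:
  assumes "f \<in> D NN" "g \<in> D NN" "n \<in> D N" "\<And>i. i \<in> D N \<Longrightarrow> sb (Sc i) n = Z \<Longrightarrow> f \<bullet> i = g \<bullet> i"
  shows "tabN f n = tabN g n"
  by (rule seq_ext[where \<sigma> = N]) (use assms in \<open>simp_all add: len_tab ent_tab\<close>)

lemma len_in [simp]: "s \<in> D (Seq N) \<Longrightarrow> lenN s \<in> D N"
  by (rule ap_in) simp_all

text \<open>The choice schema as assumed does not range over sequence types. This identity replaces
  a sequence by its entry function, of type 1, and its length, of type 0.\<close>

lemma tab_ent_len: "s \<in> D (Seq N) \<Longrightarrow> tabN (cn (Ent N) \<bullet> s) (lenN s) = s"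
  by (rule seq_ext[where \<sigma> = N]) (simp_all add: len_tab ent_tab)

text \<open>A binary function matters only through its first \<open>k\<close> values, which are the
  bits of a number below \<open>2 ^ k\<close>; conversely, the bits of any number form a binary
  function. A quantifier over type 1 thus becomes an equation.\<close>

lemma test_iff:
  assumes "T \<in> D NN" "k \<in> D N"
  shows "cv test_tm \<bullet> T \<bullet> k = Z \<longleftrightarrow> (\<forall>b\<in>D NN. binary b \<longrightarrow> T \<bullet> code (tabN b k) \<noteq> Z)"
proof -
  obtain f where f: "f \<in> D NN" "cv test_tm \<bullet> T \<bullet> k = cv search_tm \<bullet> f \<bullet> Sc (cv bound_tm \<bullet> k)"
    "\<And>c. c \<in> D N \<Longrightarrow> f \<bullet> c = T \<bullet> code (tabN (cv bit_tm \<bullet> k \<bullet> c) k)"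
    using test_eq[OF assms] by blast
  show ?thesis
  proof (intro iffI ballI HOL.impI)
    fix b assume z: "cv test_tm \<bullet> T \<bullet> k = Z" and b: "b \<in> D NN" "binary b"
    let ?c = "cv word_tm \<bullet> b \<bullet> k"
    have "f \<bullet> ?c \<noteq> Z"
      by (rule search_bounded[of "Sc (cv bound_tm \<bullet> k)"])
        (use z f b assms word_bound[OF b assms(2)] in simp_all)
    moreover have "tabN (cv bit_tm \<bullet> k \<bullet> ?c) k = tabN b k"
      by (rule tab_cong) (use b assms bit_word[OF b] in simp_all)
    ultimately show "T \<bullet> code (tabN b k) \<noteq> Z" using f(3)[of ?c] b assms by simp
  next
    assume all: "\<forall>b\<in>D NN. binary b \<longrightarrow> T \<bullet> code (tabN b k) \<noteq> Z"
    have "f \<bullet> c \<noteq> Z" if "c \<in> D N" for c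
      using all f(3)[OF that] that assms by (simp add: binary_def bit_eq par_le_one)
    then show "cv test_tm \<bullet> T \<bullet> k = Z" using search_none f(1,2) assms by simp
  qed
qed

end

section \<open>The choice functional\<close>

lemma pure_ty_1 [simp]: "pure_ty 1 = NN" "pure_ty (Suc 0) = NN"
  by simp_all

lemma pure_ty_2 [simp]: "pure_ty 2 = NN \<rightarrow> N"
  by (simp add: numeral_2_eq_2)

abbreviation "g_v \<equiv> (5, NN \<rightarrow> N)"
abbreviation "T_v \<equiv> (0, NN)"
abbreviation "k_v \<equiv> (4, N)"
abbreviation "a_v \<equiv> (1, NN)"
abbreviation "f_v \<equiv> (2, NN)"
abbreviation "n_v \<equiv> (3, N)"
abbreviation "i_v \<equiv> (7, N)"
abbreviation "m_v \<equiv> (8, N)"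

text \<open>The universal quantifiers of the premises become witnesses for their failure: \<open>tab f n\<close>,
  \<open>i\<close>, \<open>m\<close> for a failure of the tree property, \<open>a\<close> (cut off at 1, so that being binary needs no
  quantifier) for a path on which \<open>g\<close> fails.\<close>

definition choice_fm :: fm where
  "choice_fm = (let s = tab N (V f_v) (V n_v); a = trunc_tm \<cdot> V a_v; T = V T_v in
     (In_tree s T \<^bold>\<longrightarrow> Less (V i_v) (len N s) \<^bold>\<longrightarrow> Le (ent N s (V i_v)) (suc zero)) \<^bold>\<longrightarrow>
     (Le (V m_v) (len N s) \<^bold>\<longrightarrow> In_tree s T \<^bold>\<longrightarrow> In_tree (tab N (C (Ent N) \<cdot> s) (V m_v)) T) \<^bold>\<longrightarrow>
     Neg (In_tree (tab N a (V g_v \<cdot> a)) T) \<^bold>\<longrightarrow>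
     Eq (test_tm \<cdot> T \<cdot> V k_v) zero)"

text \<open>The functional chosen for \<open>k_v\<close> will be \<open>h\<close>; the other five
  return the evidence that a premise fails. Indices from 20 on keep them apart from the variables of
  \<open>choice_fm\<close>.\<close>

abbreviation choice_ax :: fm where
  "choice_ax \<equiv> qf_ac [g_v, T_v] [k_v, a_v, f_v, n_v, i_v, m_v]
     [(20, (NN \<rightarrow> N) \<rightarrow> NN \<rightarrow> N), (21, (NN \<rightarrow> N) \<rightarrow> NN \<rightarrow> NN), (22, (NN \<rightarrow> N) \<rightarrow> NN \<rightarrow> NN),
      (23, (NN \<rightarrow> N) \<rightarrow> NN \<rightarrow> N), (24, (NN \<rightarrow> N) \<rightarrow> NN \<rightarrow> N), (25, (NN \<rightarrow> N) \<rightarrow> NN \<rightarrow> N)] choice_fm"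

lemma qf_choice_fm: "qf choice_fm"
  by (simp add: choice_fm_def Let_def)

lemma choice_ax: "choice_ax \<in> QF_AC_2_1"
  unfolding QF_AC_2_1_def QF_AC_tuples_def
  by (rule CollectI, intro exI conjI, rule refl, rule qf_choice_fm)
    (auto simp: qf_ac_vars_def choice_fm_def Let_def)

lemma wff_choice_ax: "wff choice_ax"
  by (simp add: qf_ac_def Forall_list_def Exists_list_def subst_list_def choice_fm_def Let_def
      subst_tm_closed)

context model
begin

definition tree :: "'u \<Rightarrow> bool" where
  "tree T \<longleftrightarrow>
     (\<forall>s\<in>D (Seq N). T \<bullet> code s = Z \<longrightarrow> (\<forall>i\<in>D N. sb (Sc i) (lenN s) = Z \<longrightarrow> sb (entN s i) (Sc Z) = Z)) \<and>
     (\<forall>s\<in>D (Seq N). \<forall>n\<in>D N. sb n (lenN s) = Z \<longrightarrow> T \<bullet> code s = Z \<longrightarrow>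
        T \<bullet> code (tabN (cn (Ent N) \<bullet> s) n) = Z)"

definition choice_rel :: "'u \<Rightarrow> 'u \<Rightarrow> 'u \<Rightarrow> 'u \<Rightarrow> 'u \<Rightarrow> 'u \<Rightarrow> 'u \<Rightarrow> 'u \<Rightarrow> bool" where
  "choice_rel g T k a f n i m \<longleftrightarrow> (let s = tabN f n; a' = cv trunc_tm \<bullet> a in
     (T \<bullet> code s = Z \<longrightarrow> sb (Sc i) (lenN s) = Z \<longrightarrow> sb (entN s i) (Sc Z) = Z) \<longrightarrow>
     (sb m (lenN s) = Z \<longrightarrow> T \<bullet> code s = Z \<longrightarrow> T \<bullet> code (tabN (cn (Ent N) \<bullet> s) m) = Z) \<longrightarrow>
     T \<bullet> code (tabN a' (g \<bullet> a')) \<noteq> Z \<longrightarrow> cv test_tm \<bullet> T \<bullet> k = Z)"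

lemma msat_choice_fm:
  "msat e choice_fm \<longleftrightarrow> choice_rel (e g_v) (e T_v) (e k_v) (e a_v) (e f_v) (e n_v) (e i_v) (e m_v)"
  by (simp add: choice_fm_def choice_rel_def Let_def)

lemma choice:
  assumes "QF_AC_2_1 \<subseteq> Ax"
    and ex: "\<And>g T. g \<in> D (NN \<rightarrow> N) \<Longrightarrow> T \<in> D NN \<Longrightarrow>
      \<exists>k\<in>D N. \<exists>a\<in>D NN. \<exists>f\<in>D NN. \<exists>n\<in>D N. \<exists>i\<in>D N. \<exists>m\<in>D N. choice_rel g T k a f n i m"
  obtains h where "h \<in> D ((NN \<rightarrow> N) \<rightarrow> NN \<rightarrow> N)"
    "\<And>g T. g \<in> D (NN \<rightarrow> N) \<Longrightarrow> T \<in> D NN \<Longrightarrow>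
      \<exists>a\<in>D NN. \<exists>f\<in>D NN. \<exists>n\<in>D N. \<exists>i\<in>D N. \<exists>m\<in>D N. choice_rel g T (h \<bullet> g \<bullet> T) a f n i m"
proof -
  have "msat e0 choice_ax"
    using assms(1) choice_ax wff_choice_ax by (intro sat_ax) auto
  then have "\<exists>h\<in>D ((NN \<rightarrow> N) \<rightarrow> NN \<rightarrow> N). \<exists>A\<in>D ((NN \<rightarrow> N) \<rightarrow> NN \<rightarrow> NN). \<exists>F\<in>D ((NN \<rightarrow> N) \<rightarrow> NN \<rightarrow> NN).
      \<exists>n\<in>D ((NN \<rightarrow> N) \<rightarrow> NN \<rightarrow> N). \<exists>i\<in>D ((NN \<rightarrow> N) \<rightarrow> NN \<rightarrow> N). \<exists>m\<in>D ((NN \<rightarrow> N) \<rightarrow> NN \<rightarrow> N).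
      \<forall>g\<in>D (NN \<rightarrow> N). \<forall>T\<in>D NN. choice_rel g T (h \<bullet> g \<bullet> T) (A \<bullet> g \<bullet> T) (F \<bullet> g \<bullet> T)
        (n \<bullet> g \<bullet> T) (i \<bullet> g \<bullet> T) (m \<bullet> g \<bullet> T)"
    using ex
    by (simp add: qf_ac_def Forall_list_def Exists_list_def subst_list_def
        sat_subst_qf[OF qf_choice_fm] msat_choice_fm)
  then obtain h A F n i m where F: "h \<in> D ((NN \<rightarrow> N) \<rightarrow> NN \<rightarrow> N)" "A \<in> D ((NN \<rightarrow> N) \<rightarrow> NN \<rightarrow> NN)"
    "F \<in> D ((NN \<rightarrow> N) \<rightarrow> NN \<rightarrow> NN)" "n \<in> D ((NN \<rightarrow> N) \<rightarrow> NN \<rightarrow> N)" "i \<in> D ((NN \<rightarrow> N) \<rightarrow> NN \<rightarrow> N)"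
    "m \<in> D ((NN \<rightarrow> N) \<rightarrow> NN \<rightarrow> N)"
    and rel: "\<forall>g\<in>D (NN \<rightarrow> N). \<forall>T\<in>D NN. choice_rel g T (h \<bullet> g \<bullet> T) (A \<bullet> g \<bullet> T) (F \<bullet> g \<bullet> T)
        (n \<bullet> g \<bullet> T) (i \<bullet> g \<bullet> T) (m \<bullet> g \<bullet> T)"
    by blast
  have "f \<bullet> g \<bullet> T \<in> D \<sigma>" if "f \<in> D ((NN \<rightarrow> N) \<rightarrow> NN \<rightarrow> \<sigma>)" "g \<in> D (NN \<rightarrow> N)" "T \<in> D NN" for f g T \<sigma>
    using that ap by blast
  with F rel show thesis by (intro that[of h]) blast+
qed

lemma fan_ef:
  assumes "QF_AC_2_1 \<subseteq> Ax"
    and fan: "\<And>T. T \<in> D NN \<Longrightarrow> tree T \<Longrightarrow>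
      (\<And>a. a \<in> D NN \<Longrightarrow> binary a \<Longrightarrow> \<exists>n\<in>D N. T \<bullet> code (tabN a n) \<noteq> Z) \<Longrightarrow>
      \<exists>k\<in>D N. \<forall>b\<in>D NN. binary b \<longrightarrow> T \<bullet> code (tabN b k) \<noteq> Z"
  obtains h where "h \<in> D ((NN \<rightarrow> N) \<rightarrow> NN \<rightarrow> N)"
    "\<And>T g. T \<in> D NN \<Longrightarrow> g \<in> D (NN \<rightarrow> N) \<Longrightarrow> tree T \<Longrightarrow>
      (\<And>a. a \<in> D NN \<Longrightarrow> binary a \<Longrightarrow> T \<bullet> code (tabN a (g \<bullet> a)) \<noteq> Z) \<Longrightarrow>
      \<forall>b\<in>D NN. binary b \<longrightarrow> T \<bullet> code (tabN b (h \<bullet> g \<bullet> T)) \<noteq> Z"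
proof -
  have "\<exists>k\<in>D N. \<exists>a\<in>D NN. \<exists>f\<in>D NN. \<exists>n\<in>D N. \<exists>i\<in>D N. \<exists>m\<in>D N. choice_rel g T k a f n i m"
    if g: "g \<in> D (NN \<rightarrow> N)" and T: "T \<in> D NN" for g T
  proof (rule ccontr)
    assume neg: "\<not> ?thesis"
    \<comment> \<open>Failure of the relation for all values makes every premise inside
      \<open>choice_rel\<close> true and the test nonzero at each \<open>k\<close>. So
      \<open>T\<close> satisfies the assumptions of the fan theorem, with \<open>g\<close> giving
      the bar.\<close>
    have rel: "\<not> choice_rel g T k a f n i m" if "k \<in> D N" "a \<in> D NN" "f \<in> D NN" "n \<in> D N" "i \<in> D N" "m \<in> D N"
      for k a f n i m
      using neg that by blast
    have zero: "cv (zero_at NN) \<in> D NN" by (rule cv_in) simp_all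
    have "tree T"
      unfolding tree_def
    proof (intro conjI ballI HOL.impI)
      fix s i assume s: "s \<in> D (Seq N)" "T \<bullet> code s = Z" "i \<in> D N" "sb (Sc i) (lenN s) = Z"
      then show "sb (entN s i) (Sc Z) = Z"
        \<comment> \<open>The sequence \<open>s\<close> enters as the table of its own entries; the
          components foreign to this clause receive zero values.\<close>
        using rel[of Z "cv (zero_at NN)" "cn (Ent N) \<bullet> s" "lenN s" i Z] zero
        by (simp add: choice_rel_def Let_def tab_ent_len)
    next
      fix s n assume s: "s \<in> D (Seq N)" "n \<in> D N" "sb n (lenN s) = Z" "T \<bullet> code s = Z"
      then show "T \<bullet> code (tabN (cn (Ent N) \<bullet> s) n) = Z"
        using rel[of Z "cv (zero_at NN)" "cn (Ent N) \<bullet> s" "lenN s" Z n] zero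
        by (simp add: choice_rel_def Let_def tab_ent_len)
    qed
    moreover have "\<exists>n\<in>D N. T \<bullet> code (tabN a n) \<noteq> Z" if a: "a \<in> D NN" "binary a" for a
    proof -
      \<comment> \<open>By extensionality the cut-off function is \<open>a\<close> itself, so
        \<open>g\<close> takes the same value on both.\<close>
      have "cv trunc_tm \<bullet> a = a"
        by (rule fun_ext[of _ N N]) (use a in \<open>simp_all add: trunc_id binary_def\<close>)
      then have "T \<bullet> code (tabN a (g \<bullet> a)) \<noteq> Z"
        using rel[of Z a a Z Z Z] a by (simp add: choice_rel_def Let_def)
      then show ?thesis using a g by (intro bexI[of _ "g \<bullet> a"]) simp_all
    qed
    ultimately obtain k where "k \<in> D N" "\<forall>b\<in>D NN. binary b \<longrightarrow> T \<bullet> code (tabN b k) \<noteq> Z"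
      using fan[OF T] by blast
    then show False
      \<comment> \<open>The uniform bound makes the test 0 at \<open>k\<close>, and then the
        relation holds whatever evidence is supplied.\<close>
      using rel[of k "cv (zero_at NN)" "cv (zero_at NN)" Z Z Z] zero test_iff[OF T]
      by (simp add: choice_rel_def Let_def)
  qed
  then obtain h where h: "h \<in> D ((NN \<rightarrow> N) \<rightarrow> NN \<rightarrow> N)"
    "\<And>g T. g \<in> D (NN \<rightarrow> N) \<Longrightarrow> T \<in> D NN \<Longrightarrow>
      \<exists>a\<in>D NN. \<exists>f\<in>D NN. \<exists>n\<in>D N. \<exists>i\<in>D N. \<exists>m\<in>D N. choice_rel g T (h \<bullet> g \<bullet> T) a f n i m"
    using choice[OF assms(1)] by blast
  show thesis
  proof (rule that[OF h(1)])
    fix T g assume T: "T \<in> D NN" and g: "g \<in> D (NN \<rightarrow> N)" and tree: "tree T"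
      and bar: "\<And>a. a \<in> D NN \<Longrightarrow> binary a \<Longrightarrow> T \<bullet> code (tabN a (g \<bullet> a)) \<noteq> Z"
    obtain a f n i m where *: "a \<in> D NN" "f \<in> D NN" "n \<in> D N" "i \<in> D N" "m \<in> D N"
      "choice_rel g T (h \<bullet> g \<bullet> T) a f n i m"
      using h(2)[OF g T] by blast
    \<comment> \<open>Choice may return any \<open>a\<close>, but its cut-off is binary, so the
      premise on \<open>g\<close> rules it out as evidence.\<close>
    have "binary (cv trunc_tm \<bullet> a)" using * by (simp add: binary_def trunc_binary)
    then have "T \<bullet> code (tabN (cv trunc_tm \<bullet> a) (g \<bullet> (cv trunc_tm \<bullet> a))) \<noteq> Z" using bar * by simp
    moreover have "tabN f n \<in> D (Seq N)" using * by simp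
    ultimately have "cv test_tm \<bullet> T \<bullet> (h \<bullet> g \<bullet> T) = Z"
      using *(4-6) tree unfolding choice_rel_def tree_def Let_def by blast
    moreover have "h \<bullet> g \<bullet> T \<in> D N" using ap h(1) g T by blast
    ultimately show "\<forall>b\<in>D NN. binary b \<longrightarrow> T \<bullet> code (tabN b (h \<bullet> g \<bullet> T)) \<noteq> Z"
      using test_iff[OF T] by blast
  qed
qed

text \<open>The side condition excludes capture by the binders of \<open>Bin_tree\<close>. Since
  variables carry their types, the type \<open>NN\<close> alone suffices, even at index 0.\<close>

lemma msat_Bin_tree:
  "fst v \<notin> {0, 1, 2} \<or> snd v = NN \<Longrightarrow> msat e (Bin_tree (V v)) \<longleftrightarrow> tree (e v)"
  by (cases v) (auto simp: Bin_tree_def tree_def Let_def)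

lemma msat_Binary: "snd v = NN \<Longrightarrow> msat e (Binary (V v)) \<longleftrightarrow> binary (e v)"
  by (cases v) (auto simp: Binary_def binary_def Let_def)

lemma msat_FAN_imp_FAN_ef:
  assumes "QF_AC_2_1 \<subseteq> Ax"
  shows "msat e (FAN \<^bold>\<longrightarrow> Exists h_var (FAN_ef (V h_var)))"
proof -
  have "\<exists>h\<in>D ((NN \<rightarrow> N) \<rightarrow> NN \<rightarrow> N). msat (e(h_var := h)) (FAN_ef (V h_var))" if "msat e FAN"
  proof -
    have "\<exists>k\<in>D N. \<forall>b\<in>D NN. binary b \<longrightarrow> T \<bullet> code (tabN b k) \<noteq> Z"
      if "T \<in> D NN" "tree T" "\<And>a. a \<in> D NN \<Longrightarrow> binary a \<Longrightarrow> \<exists>n\<in>D N. T \<bullet> code (tabN a n) \<noteq> Z" for T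
      using \<open>msat e FAN\<close> that by (simp add: FAN_def Let_def msat_Bin_tree msat_Binary)
    then obtain h where "h \<in> D ((NN \<rightarrow> N) \<rightarrow> NN \<rightarrow> N)"
      "\<And>T g. T \<in> D NN \<Longrightarrow> g \<in> D (NN \<rightarrow> N) \<Longrightarrow> tree T \<Longrightarrow>
        (\<And>a. a \<in> D NN \<Longrightarrow> binary a \<Longrightarrow> T \<bullet> code (tabN a (g \<bullet> a)) \<noteq> Z) \<Longrightarrow>
        \<forall>b\<in>D NN. binary b \<longrightarrow> T \<bullet> code (tabN b (h \<bullet> g \<bullet> T)) \<noteq> Z"
      using fan_ef[OF assms] by blast
    then show ?thesis
      by (intro bexI[of _ h]) (simp_all add: FAN_ef_def Let_def msat_Bin_tree msat_Binary h_var_def)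
  qed
  then show ?thesis by (auto simp: h_var_def)
qed

end

lemma wff_FAN_imp_FAN_ef: "wff (FAN \<^bold>\<longrightarrow> Exists h_var (FAN_ef (V h_var)))"
  by (simp add: FAN_def FAN_ef_def Bin_tree_def Binary_def h_var_def Let_def)

theorem theorem4p22:
  "RCA0_omega \<union> QF_AC_2_1 \<turnstile> FAN \<^bold>\<longrightarrow> Exists h_var (FAN_ef (V h_var))"
proof (rule completeness)
  show "EPRA \<subseteq> RCA0_omega \<union> QF_AC_2_1" by (auto simp: RCA0_omega_def)
  show "sat D cn ap (=) e (FAN \<^bold>\<longrightarrow> Exists h_var (FAN_ef (V h_var)))"
    if "model (RCA0_omega \<union> QF_AC_2_1) D cn ap" for D :: "ty \<Rightarrow> tm set set" and cn ap e
    by (rule model.msat_FAN_imp_FAN_ef[OF that]) simp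
qed (rule wff_FAN_imp_FAN_ef)

end
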